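(* The satisfiability problem for the fragment of $\mathrm{LTLf}^+$ consisting of formulas of the form $\forall\Phi$, with $\Phi$ an LTLf formula, is EXPSPACE-hard.
   Context: $AP$ is a finite nonempty set of atoms, $\Sigma=2^{AP}$. LTLf formulas: $\varphi::=p\mid\neg\varphi\mid\varphi\wedge\varphi\mid X\varphi\mid\varphi U\varphi$ ($p\in AP$) interpreted on nonempty finite traces $\tau$: $\tau,i\models p$ iff $p\in\tau_i$; Boolean connectives as usual; $\tau,i\models X\varphi$ iff $i+1<|\tau|$ and $\tau,i+1\models\varphi$; $\tau,i\models\varphi_1U\varphi_2$ iff there is $k$ with $i\le k<|\tau|$, $\tau,k\models\varphi_2$ and $\tau,j\models\varphi_1$ for all $i\le j<k$; $[\Phi]$ is the set of nonempty finite traces with $\tau,0\models\Phi$. The formula $\forall\Phi$ denotes the set of infinite traces over $\Sigma$ all of whose nonempty finite prefixes lie in $[\Phi]$; it is satisfiable iff this set is nonempty. Hardness is with respect to the size of $\Phi$. *)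

theory Defs
  imports "HOL-Computational_Algebra.Polynomial"
begin

datatype (atoms: 'a) ltlf =
    Prop 'a
  | Neg "'a ltlf"
  | Conj "'a ltlf" "'a ltlf"
  | Next "'a ltlf"
  | Until "'a ltlf" "'a ltlf"

text \<open>The clause for \<^term>\<open>Prop p\<close> is only meant for positions \<open>i < length \<tau>\<close>; starting from
  position 0 of a nonempty trace no other positions are reached.\<close>

primrec holds :: "'a set list \<Rightarrow> nat \<Rightarrow> 'a ltlf \<Rightarrow> bool" where
  "holds \<tau> i (Prop p) \<longleftrightarrow> p \<in> \<tau> ! i"
| "holds \<tau> i (Neg \<phi>) \<longleftrightarrow> \<not> holds \<tau> i \<phi>"
| "holds \<tau> i (Conj \<phi> \<psi>) \<longleftrightarrow> holds \<tau> i \<phi> \<and> holds \<tau> i \<psi>"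
| "holds \<tau> i (Next \<phi>) \<longleftrightarrow> i + 1 < length \<tau> \<and> holds \<tau> (i + 1) \<phi>"
| "holds \<tau> i (Until \<phi> \<psi>) \<longleftrightarrow>
     (\<exists>k. i \<le> k \<and> k < length \<tau> \<and> holds \<tau> k \<psi> \<and> (\<forall>j. i \<le> j \<and> j < k \<longrightarrow> holds \<tau> j \<phi>))"

definition finite_traces :: "'a set \<Rightarrow> 'a ltlf \<Rightarrow> 'a set list set" where
  "finite_traces AP \<Phi> = {\<tau>. \<tau> \<noteq> [] \<and> set \<tau> \<subseteq> Pow AP \<and> holds \<tau> 0 \<Phi>}"

definition forall_traces :: "'a set \<Rightarrow> 'a ltlf \<Rightarrow> (nat \<Rightarrow> 'a set) set" where
  "forall_traces AP \<Phi> =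
     {w. range w \<subseteq> Pow AP \<and> (\<forall>n\<ge>1. map w [0..<n] \<in> finite_traces AP \<Phi>)}"

definition forall_satisfiable :: "'a set \<Rightarrow> 'a ltlf \<Rightarrow> bool" where
  "forall_satisfiable AP \<Phi> \<longleftrightarrow> forall_traces AP \<Phi> \<noteq> {}"

lemma finite_nonempty_atoms: "finite (atoms \<Phi>)" "atoms \<Phi> \<noteq> {}"
  by (induction \<Phi>) auto

lemma holds_restrict:
  assumes "atoms \<Phi> \<subseteq> A" "i < length \<tau>"
  shows "holds (map (\<lambda>a. a \<inter> A) \<tau>) i \<Phi> \<longleftrightarrow> holds \<tau> i \<Phi>"
  using assms
proof (induction \<Phi> arbitrary: i)
  case (Until \<phi> \<psi>)
  have sub: "atoms \<phi> \<subseteq> A" "atoms \<psi> \<subseteq> A"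
    using Until.prems(1) by simp_all
  have "holds (map (\<lambda>a. a \<inter> A) \<tau>) k \<phi> = holds \<tau> k \<phi>"
    and "holds (map (\<lambda>a. a \<inter> A) \<tau>) k \<psi> = holds \<tau> k \<psi>" if "k < length \<tau>" for k
    using Until.IH sub that by blast+
  then show ?case
    unfolding holds.simps length_map by (meson order.strict_trans)
qed auto

lemma forall_satisfiable_atoms:
  assumes "atoms \<Phi> \<subseteq> AP"
  shows "forall_satisfiable AP \<Phi> \<longleftrightarrow> forall_satisfiable (atoms \<Phi>) \<Phi>"
proof
  assume "forall_satisfiable AP \<Phi>"
  then obtain w where w: "\<And>n. n \<ge> 1 \<Longrightarrow> holds (map w [0..<n]) 0 \<Phi>"
    by (auto simp: forall_satisfiable_def forall_traces_def finite_traces_def)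
  have "holds (map (\<lambda>i. w i \<inter> atoms \<Phi>) [0..<n]) 0 \<Phi>" if "n \<ge> 1" for n
    using w[OF that] holds_restrict[of \<Phi> "atoms \<Phi>" 0 "map w [0..<n]"] that
    by (simp add: comp_def)
  then have "(\<lambda>i. w i \<inter> atoms \<Phi>) \<in> forall_traces (atoms \<Phi>) \<Phi>"
    by (auto simp: forall_traces_def finite_traces_def)
  then show "forall_satisfiable (atoms \<Phi>) \<Phi>"
    by (auto simp: forall_satisfiable_def)
next
  assume "forall_satisfiable (atoms \<Phi>) \<Phi>"
  then obtain w where "w \<in> forall_traces (atoms \<Phi>) \<Phi>"
    by (auto simp: forall_satisfiable_def)
  moreover have "Pow (atoms \<Phi>) \<subseteq> Pow AP"
    using assms by (rule Pow_mono)
  ultimately have "w \<in> forall_traces AP \<Phi>"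
    unfolding forall_traces_def finite_traces_def mem_Collect_eq by (meson subset_trans)
  then show "forall_satisfiable AP \<Phi>"
    by (auto simp: forall_satisfiable_def)
qed

text \<open>Polish notation with three-bit tokens. Atoms are written in unary; since unary indices can
  be rewritten in binary in polynomial time, hardness for this encoding is at least as strong as
  hardness for an encoding with binary indices.\<close>

primrec encode :: "nat ltlf \<Rightarrow> bool list" where
  "encode (Prop n) = [False, False, False] @ replicate n True @ [False]"
| "encode (Neg \<phi>) = [False, False, True] @ encode \<phi>"
| "encode (Conj \<phi> \<psi>) = [False, True, False] @ encode \<phi> @ encode \<psi>"
| "encode (Next \<phi>) = [False, True, True] @ encode \<phi>"
| "encode (Until \<phi> \<psi>) = [True, False, False] @ encode \<phi> @ encode \<psi>"

lemma replicate_True_False_eq: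
  "replicate m True @ False # u = replicate n True @ False # v \<longleftrightarrow> m = n \<and> u = v"
proof (induction m arbitrary: n)
  case 0
  then show ?case by (cases n) auto
next
  case (Suc m)
  then show ?case by (cases n) auto
qed

lemma encode_append_eq: "encode \<phi> @ u = encode \<psi> @ v \<Longrightarrow> \<phi> = \<psi> \<and> u = v"
proof (induction \<phi> arbitrary: \<psi> u v)
  case (Prop n)
  then show ?case by (cases \<psi>) (auto simp: replicate_True_False_eq)
next
  case (Neg \<phi>)
  from Neg.prems show ?case by (cases \<psi>) (auto dest: Neg.IH)
next
  case (Conj \<phi>1 \<phi>2)
  from Conj.prems show ?case by (cases \<psi>) (auto dest!: Conj.IH)
next
  case (Next \<phi>)
  from Next.prems show ?case by (cases \<psi>) (auto dest: Next.IH)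
next
  case (Until \<phi>1 \<phi>2)
  from Until.prems show ?case by (cases \<psi>) (auto dest!: Until.IH)
qed

lemma inj_encode: "inj encode"
proof (rule injI)
  fix \<phi> \<psi>
  assume "encode \<phi> = encode \<psi>"
  then show "\<phi> = \<psi>" using encode_append_eq[of \<phi> "[]" \<psi> "[]"] by simp
qed

text \<open>As usual for satisfiability problems, the atoms are part of the input: an instance is a
  formula, read over the finite nonempty set of its own atoms. By \<open>forall_satisfiable_atoms\<close>
  any larger set gives the same answer. The outermost universal quantifier is common to all
  instances and is not encoded.\<close>

definition forall_SAT :: "bool list set" where
  "forall_SAT = {encode \<Phi> | \<Phi>. forall_satisfiable (atoms \<Phi>) \<Phi>}"

text \<open>Deterministic multi-tape machines on one-sided tapes. States and tape symbols are initial
  segments of the natural numbers; symbol 0 is the blank, 1 the left-end marker, and 2 and 3 stand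
  for the bits \<^const>\<open>False\<close> and \<^const>\<open>True\<close>. In one step the machine reads the list of
  scanned symbols, one per tape, and answers with a new state and, for each tape, the symbol to
  write and a head movement.\<close>

datatype move = Left | Stay | Right

record tm =
  num_tapes :: nat
  num_states :: nat
  num_symbols :: nat
  start :: nat
  accept :: nat
  reject :: nat
  delta :: "nat \<Rightarrow> nat list \<Rightarrow> nat \<times> (nat \<times> move) list"

definition turing_machine :: "tm \<Rightarrow> bool" where
  "turing_machine M \<longleftrightarrow>
     num_tapes M \<ge> 1 \<and> num_symbols M \<ge> 4 \<and>
     start M < num_states M \<and> accept M < num_states M \<and> reject M < num_states M \<and>
     accept M \<noteq> reject M \<and>
     (\<forall>q < num_states M. \<forall>ss. length ss = num_tapes M \<and> set ss \<subseteq> {..<num_symbols M} \<longrightarrow>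
        (case delta M q ss of (q', as) \<Rightarrow>
           q' < num_states M \<and> length as = num_tapes M \<and> fst ` set as \<subseteq> {..<num_symbols M}))"

text \<open>A tape consists of the head position and the contents; a configuration consists of the
  state and the tapes.\<close>

type_synonym tape = "nat \<times> (nat \<Rightarrow> nat)"
type_synonym config = "nat \<times> tape list"

fun read :: "tape \<Rightarrow> nat" where
  "read (h, c) = c h"

text \<open>Moving left from cell 0 leaves the head where it is, by truncated subtraction.\<close>

fun move_head :: "move \<Rightarrow> nat \<Rightarrow> nat" where
  "move_head Left h = h - 1"
| "move_head Stay h = h"
| "move_head Right h = h + 1"

fun act :: "nat \<times> move \<Rightarrow> tape \<Rightarrow> tape" where
  "act (s, m) (h, c) = (move_head m h, c(h := s))"

fun step :: "tm \<Rightarrow> config \<Rightarrow> config" where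
  "step M (q, ts) =
     (if q = accept M \<or> q = reject M then (q, ts)
      else case delta M q (map read ts) of (q', as) \<Rightarrow> (q', map2 act as ts))"

definition contents_of :: "bool list \<Rightarrow> nat \<Rightarrow> nat" where
  "contents_of x i =
     (if i = 0 then 1 else if i \<le> length x then (if x ! (i - 1) then 3 else 2) else 0)"

definition initial :: "tm \<Rightarrow> bool list \<Rightarrow> config" where
  "initial M x =
     (start M, (0, contents_of x) # replicate (num_tapes M - 1) (0, contents_of []))"

definition run :: "tm \<Rightarrow> bool list \<Rightarrow> nat \<Rightarrow> config" where
  "run M x t = (step M ^^ t) (initial M x)"

definition decides :: "tm \<Rightarrow> bool list set \<Rightarrow> bool" where
  "decides M L \<longleftrightarrow>
     (\<forall>x. \<exists>t. fst (run M x t) = (if x \<in> L then accept M else reject M))"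

text \<open>The space bound applies to each tape separately; for exponential bounds this agrees with
  bounding the total over all tapes.\<close>

definition runs_in_space :: "tm \<Rightarrow> (nat \<Rightarrow> nat) \<Rightarrow> bool" where
  "runs_in_space M s \<longleftrightarrow>
     (\<forall>x t. \<forall>T \<in> set (snd (run M x t)). fst T < s (length x))"

definition EXPSPACE :: "bool list set set" where
  "EXPSPACE =
     {L. \<exists>M (p :: nat poly). turing_machine M \<and> decides M L \<and>
           runs_in_space M (\<lambda>n. 2 ^ poly p n)}"

text \<open>The output is the contents of the last tape.\<close>

definition computes_in_time :: "tm \<Rightarrow> (bool list \<Rightarrow> bool list) \<Rightarrow> (nat \<Rightarrow> nat) \<Rightarrow> bool" where
  "computes_in_time M f T \<longleftrightarrow>
     (\<forall>x. \<exists>t \<le> T (length x). fst (run M x t) = accept M \<and>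
            snd (last (snd (run M x t))) = contents_of (f x))"

definition polytime_computable :: "(bool list \<Rightarrow> bool list) \<Rightarrow> bool" where
  "polytime_computable f \<longleftrightarrow>
     (\<exists>M (p :: nat poly). turing_machine M \<and> computes_in_time M f (poly p))"

definition polytime_reducible :: "bool list set \<Rightarrow> bool list set \<Rightarrow> bool" where
  "polytime_reducible A B \<longleftrightarrow> (\<exists>f. polytime_computable f \<and> (\<forall>x. x \<in> A \<longleftrightarrow> f x \<in> B))"

definition EXPSPACE_hard :: "bool list set \<Rightarrow> bool" where
  "EXPSPACE_hard B \<longleftrightarrow> (\<forall>A \<in> EXPSPACE. polytime_reducible A B)"

end

theory Submission
  imports Defs "HOL-Library.Countable"
begin

text \<open>
  Let \<open>M\<close> decide a language in space \<open>2 ^ m\<close>, with \<open>m\<close> polynomial in the input length. A trace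
  has one position per step of \<open>M\<close>, recording the state, the scanned symbols and the head
  positions, the latter as binary numbers of \<open>m\<close> bits; tape contents are not recorded. They are
  recovered from the history: a scanned symbol is correct iff it is the one written at the last
  earlier visit of the same cell. Since the formula has to hold on all prefixes, it suffices to
  check this for the last position of the prefix, whose head position can be compared bit by bit
  with any earlier one. A trace satisfying all constraints is a non-rejecting run of \<open>M\<close>.

  The formula is a fixed schema in which some conjunctions range over the \<open>m\<close> bit positions, so a
  machine with a few counters prints it; \<open>m = a * (n + 1) ^ d\<close> is computed by repeated
  multiplication.
\<close>

section \<open>Composable programs on Turing machine tapes\<close>

text \<open>Quantifying over prefixes is what gives the fragment its strength. Within one trace,
  temporal operators offer no evident short way to compare two \<open>m\<close>-bit numbers at
  arbitrary positions, since one of them would have to be remembered. The end of a trace, however,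
  is definable from every position, and as the prefix grows its end passes through all positions.

  The price is that only safety conditions can be imposed. A requirement on a successor must be
  vacuous at the end of a prefix, and acceptance cannot be demanded as a future event. It need not
  be: a machine that decides its language halts on every input and its halting states repeat
  forever, so membership means never rejecting.

  The initial tapes are made part of the history: a preamble of the trace writes them, and the rule
  of the last visit then covers the input as well.\<close>

datatype cmd =
    Skip
  | Go nat move
  | Out bool
  | Seq cmd cmd
  | While nat nat cmd
  | IfSym nat nat cmd cmd

definition idle :: "nat list \<Rightarrow> (nat \<times> move) list" where
  "idle ss = map (\<lambda>s. (s, Stay)) ss"

text \<open>The control state is the stack of pending commands. Only \<open>Go\<close> moves a head,
  and only \<open>Out\<close> changes a symbol, always on the last tape, where
  \<open>computes_in_time\<close> expects the result.\<close>

fun cmd_delta :: "cmd list \<Rightarrow> nat list \<Rightarrow> cmd list \<times> (nat \<times> move) list" where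
  "cmd_delta [] ss = ([], idle ss)"
| "cmd_delta (Skip # ks) ss = (ks, idle ss)"
| "cmd_delta (Go r d # ks) ss = (ks, (idle ss)[r := (ss ! r, d)])"
| "cmd_delta (Out b # ks) ss = (ks, (idle ss)[length ss - 1 := (if b then 3 else 2, Stay)])"
| "cmd_delta (Seq c d # ks) ss = (c # d # ks, idle ss)"
| "cmd_delta (While r s c # ks) ss = (if ss ! r = s then ks else c # While r s c # ks, idle ss)"
| "cmd_delta (IfSym r s c d # ks) ss = ((if ss ! r = s then c else d) # ks, idle ss)"

fun cmd_step :: "cmd list \<times> tape list \<Rightarrow> cmd list \<times> tape list" where
  "cmd_step (ks, ts) =
     (case cmd_delta ks (map read ts) of (ks', as) \<Rightarrow> (ks', map2 act as ts))"

text \<open>A finite set containing every stack that can occur between \<open>c # ks\<close> and the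
  moment \<open>ks\<close> is uncovered. It is finite because a loop body returns to the very stack
  from which the loop was entered. These stacks become the states of the Turing machine.\<close>

primrec control_points :: "cmd \<Rightarrow> cmd list \<Rightarrow> cmd list set" where
  "control_points Skip ks = {Skip # ks}"
| "control_points (Go r d) ks = {Go r d # ks}"
| "control_points (Out b) ks = {Out b # ks}"
| "control_points (Seq c d) ks =
     insert (Seq c d # ks) (control_points c (d # ks) \<union> control_points d ks)"
| "control_points (While r s c) ks =
     insert (While r s c # ks) (control_points c (While r s c # ks))"
| "control_points (IfSym r s c d) ks =
     insert (IfSym r s c d # ks) (control_points c ks \<union> control_points d ks)"

lemma finite_control_points: "finite (control_points c ks)"
  by (induction c arbitrary: ks) auto

lemma Cons_in_control_points: "c # ks \<in> control_points c ks"
  by (cases c) auto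

lemma control_points_closed:
  "k \<in> control_points c ks \<Longrightarrow> fst (cmd_delta k ss) \<in> insert ks (control_points c ks)"
proof (induction c arbitrary: ks)
  case (Seq c d)
  have "k = Seq c d # ks \<or> k \<in> control_points c (d # ks) \<or> k \<in> control_points d ks"
    using Seq.prems by simp
  then show ?case
    using Seq.IH(1)[of "d # ks"] Seq.IH(2)[of ks] Cons_in_control_points[of c "d # ks"]
      Cons_in_control_points[of d ks] by auto
next
  case (While r s c)
  have "k = While r s c # ks \<or> k \<in> control_points c (While r s c # ks)"
    using While.prems by simp
  then show ?case
    using While.IH[of "While r s c # ks"] Cons_in_control_points[of c "While r s c # ks"]
    by (auto simp del: cmd_delta.simps) (auto split: if_splits)
next
  case (IfSym r s c d)
  have "k = IfSym r s c d # ks \<or> k \<in> control_points c ks \<or> k \<in> control_points d ks"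
    using IfSym.prems by simp
  then show ?case
    using IfSym.IH(1)[of ks] IfSym.IH(2)[of ks] Cons_in_control_points[of c ks]
      Cons_in_control_points[of d ks] by auto
qed auto

lemma length_cmd_delta: "length (snd (cmd_delta k ss)) = length ss"
  by (cases "(k, ss)" rule: cmd_delta.cases) (auto simp: idle_def)

lemma symbols_cmd_delta:
  assumes "set ss \<subseteq> {..<4}"
  shows "fst ` set (snd (cmd_delta k ss)) \<subseteq> {..<4}"
proof -
  have idle: "fst ` set (idle ss) \<subseteq> {..<4}"
    using assms by (auto simp: idle_def)
  have upd: "fst ` set ((idle ss)[r := a]) \<subseteq> {..<4}" if "r < length ss \<Longrightarrow> fst a < 4" for r a
  proof (cases "r < length ss")
    case True
    then show ?thesis
      using set_update_subset_insert[of "idle ss" r a] idle that by fastforce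
  next
    case False
    then show ?thesis
      using idle by (simp add: idle_def list_update_beyond)
  qed
  have nth: "r < length ss \<Longrightarrow> ss ! r < 4" for r
    using assms nth_mem by blast
  show ?thesis
    by (cases "(k, ss)" rule: cmd_delta.cases) (use idle upd nth in \<open>auto simp del: set_map\<close>)
qed

lemma act_read: "act (read T, Stay) T = T"
  by (cases T) simp

lemma map2_act_update:
  "map2 act ((idle (map read ts))[r := a]) ts = ts[r := act a (ts ! r)]"
proof (rule nth_equalityI)
  fix i assume "i < length (map2 act ((idle (map read ts))[r := a]) ts)"
  then show "map2 act ((idle (map read ts))[r := a]) ts ! i = ts[r := act a (ts ! r)] ! i"
    by (cases "i = r") (simp_all add: idle_def act_read)
qed (simp add: idle_def)

lemma map2_act_idle: "map2 act (idle (map read ts)) ts = ts"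
  by (rule nth_equalityI) (auto simp: idle_def act_read)

text \<open>Quantifying over the continuation \<open>ks\<close> makes executions compose.\<close>

definition exec :: "cmd \<Rightarrow> tape list \<Rightarrow> tape list \<Rightarrow> nat \<Rightarrow> bool" where
  "exec c ts ts' T \<longleftrightarrow> (\<exists>t\<le>T. \<forall>ks. (cmd_step ^^ t) (c # ks, ts) = (ks, ts'))"

lemma exec_mono: "exec c ts ts' T \<Longrightarrow> T \<le> T' \<Longrightarrow> exec c ts ts' T'"
  unfolding exec_def by (meson order_trans)

text \<open>\<open>Seq\<close> and the entry into a loop body both spend one step on pushing two
  commands, so one composition rule serves both; the additional 1 pays for that step.\<close>

lemma exec_then:
  assumes "\<And>ks. cmd_step (c # ks, ts) = (d # e # ks, ts)"
    and "exec d ts ts1 T1" "exec e ts1 ts2 T2"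
  shows "exec c ts ts2 (T1 + T2 + 1)"
proof -
  obtain t1 where t1: "t1 \<le> T1" "\<And>ks. (cmd_step ^^ t1) (d # ks, ts) = (ks, ts1)"
    using assms(2) by (auto simp: exec_def)
  obtain t2 where t2: "t2 \<le> T2" "\<And>ks. (cmd_step ^^ t2) (e # ks, ts1) = (ks, ts2)"
    using assms(3) by (auto simp: exec_def)
  have "(cmd_step ^^ (t2 + t1 + 1)) (c # ks, ts) = (ks, ts2)" for ks
    unfolding funpow_add o_apply using assms(1) t1(2) t2(2) by simp
  moreover have "t2 + t1 + 1 \<le> T1 + T2 + 1"
    using t1(1) t2(1) by simp
  ultimately show ?thesis
    unfolding exec_def by blast
qed

lemma exec_one: "(\<And>ks. cmd_step (c # ks, ts) = (ks, ts')) \<Longrightarrow> exec c ts ts' 1"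
  unfolding exec_def by (rule exI[of _ 1]) simp

lemma exec_Skip: "exec Skip ts ts 1"
  by (rule exec_one) (simp add: map2_act_idle)

lemma exec_Go:
  assumes "r < length ts"
  shows "exec (Go r d) ts (ts[r := (move_head d (fst (ts ! r)), snd (ts ! r))]) 1"
proof -
  have "act (read (ts ! r), d) (ts ! r) = (move_head d (fst (ts ! r)), snd (ts ! r))"
    by (cases "ts ! r") simp
  then show ?thesis
    using assms by (intro exec_one) (simp add: map2_act_update)
qed

lemma exec_Out:
  assumes "ts \<noteq> []"
  shows "exec (Out b) ts (ts[length ts - 1 := act (if b then 3 else 2, Stay) (last ts)]) 1"
  using assms by (intro exec_one) (simp add: map2_act_update last_conv_nth)

lemma exec_Seq: "exec c ts ts1 T1 \<Longrightarrow> exec d ts1 ts2 T2 \<Longrightarrow> exec (Seq c d) ts ts2 (T1 + T2 + 1)"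
  by (rule exec_then[where d = c and e = d]) (simp_all add: map2_act_idle)

lemma exec_While_exit:
  assumes "r < length ts" "read (ts ! r) = s"
  shows "exec (While r s c) ts ts 1"
  using assms by (intro exec_one) (simp add: map2_act_idle)

lemma exec_While_enter:
  assumes "r < length ts" "read (ts ! r) \<noteq> s" "exec c ts ts1 T1" "exec (While r s c) ts1 ts2 T2"
  shows "exec (While r s c) ts ts2 (T1 + T2 + 1)"
  using assms
  by (intro exec_then[where d = c and e = "While r s c"]) (simp_all add: map2_act_idle)

lemma exec_IfSym:
  assumes "r < length ts" "exec (if read (ts ! r) = s then c else d) ts ts' T"
  shows "exec (IfSym r s c d) ts ts' (T + 1)"
proof -
  obtain t where t: "t \<le> T"
    "\<And>ks. (cmd_step ^^ t) ((if read (ts ! r) = s then c else d) # ks, ts) = (ks, ts')"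
    using assms(2) by (auto simp: exec_def)
  have "(cmd_step ^^ (t + 1)) (IfSym r s c d # ks, ts) = (ks, ts')" for ks
    unfolding funpow_add o_apply using assms(1) t(2)[of ks] by (simp add: map2_act_idle)
  then show ?thesis
    unfolding exec_def using t(1) by (meson add_le_mono1)
qed

text \<open>\<open>F v\<close> describes the tapes when \<open>v\<close> rounds remain, which makes
  one round the passage from \<open>F (Suc v)\<close> to \<open>F v\<close>. Each round costs one
  test besides the body, and one more test ends the loop.\<close>

lemma exec_countdown:
  assumes "\<And>v. v < N \<Longrightarrow>
      r < length (F (Suc v)) \<and> read (F (Suc v) ! r) \<noteq> s \<and> exec c (F (Suc v)) (F v) T"
    and "r < length (F 0)" "read (F 0 ! r) = s"
  shows "exec (While r s c) (F N) (F 0) (N * (T + 1) + 1)"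
  using assms(1)
proof (induction N)
  case 0
  then show ?case
    using exec_While_exit[OF assms(2,3)] by simp
next
  case (Suc N)
  have "exec (While r s c) (F (Suc N)) (F 0) (T + (N * (T + 1) + 1) + 1)"
    using Suc by (intro exec_While_enter[where ?ts1.0 = "F N"]) simp_all
  then show ?case
    by (rule exec_mono) simp
qed

text \<open>The commands operate on six tapes: the input, four counters represented by head positions
  on otherwise unmodified tapes (so that a counter is zero iff its head sees the marker 1), and
  the output, whose head rests on the last bit written.\<close>

definition tapes ::
  "bool list \<Rightarrow> nat \<Rightarrow> nat \<Rightarrow> nat \<Rightarrow> nat \<Rightarrow> nat \<Rightarrow> bool list \<Rightarrow> tape list" where
  "tapes x h k1 k2 k3 k4 out =
     [(h, contents_of x), (k1, contents_of []), (k2, contents_of []), (k3, contents_of []),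
      (k4, contents_of []), (length out, contents_of out)]"

lemma length_tapes [simp]: "length (tapes x h k1 k2 k3 k4 out) = 6"
  by (simp add: tapes_def)

lemma nth_tapes [simp]:
  "tapes x h k1 k2 k3 k4 out ! 0 = (h, contents_of x)"
  "tapes x h k1 k2 k3 k4 out ! 1 = (k1, contents_of [])"
  "tapes x h k1 k2 k3 k4 out ! Suc 0 = (k1, contents_of [])"
  "tapes x h k1 k2 k3 k4 out ! 2 = (k2, contents_of [])"
  "tapes x h k1 k2 k3 k4 out ! 3 = (k3, contents_of [])"
  "tapes x h k1 k2 k3 k4 out ! 4 = (k4, contents_of [])"
  by (simp_all add: tapes_def)

lemma update_tapes [simp]:
  "(tapes x h k1 k2 k3 k4 out)[0 := (i, contents_of x)] = tapes x i k1 k2 k3 k4 out"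
  "(tapes x h k1 k2 k3 k4 out)[1 := (i, contents_of [])] = tapes x h i k2 k3 k4 out"
  "(tapes x h k1 k2 k3 k4 out)[Suc 0 := (i, contents_of [])] = tapes x h i k2 k3 k4 out"
  "(tapes x h k1 k2 k3 k4 out)[2 := (i, contents_of [])] = tapes x h k1 i k3 k4 out"
  "(tapes x h k1 k2 k3 k4 out)[3 := (i, contents_of [])] = tapes x h k1 k2 i k4 out"
  "(tapes x h k1 k2 k3 k4 out)[4 := (i, contents_of [])] = tapes x h k1 k2 k3 i out"
  by (simp_all add: tapes_def numeral_eq_Suc)

lemma exec_Go_tapes:
  "exec (Go 0 d) (tapes x h k1 k2 k3 k4 out) (tapes x (move_head d h) k1 k2 k3 k4 out) 1"
  "exec (Go 1 d) (tapes x h k1 k2 k3 k4 out) (tapes x h (move_head d k1) k2 k3 k4 out) 1"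
  "exec (Go 2 d) (tapes x h k1 k2 k3 k4 out) (tapes x h k1 (move_head d k2) k3 k4 out) 1"
  "exec (Go 3 d) (tapes x h k1 k2 k3 k4 out) (tapes x h k1 k2 (move_head d k3) k4 out) 1"
  "exec (Go 4 d) (tapes x h k1 k2 k3 k4 out) (tapes x h k1 k2 k3 (move_head d k4) out) 1"
  using exec_Go[of 0 "tapes x h k1 k2 k3 k4 out" d] exec_Go[of 1 "tapes x h k1 k2 k3 k4 out" d]
    exec_Go[of 2 "tapes x h k1 k2 k3 k4 out" d] exec_Go[of 3 "tapes x h k1 k2 k3 k4 out" d]
    exec_Go[of 4 "tapes x h k1 k2 k3 k4 out" d]
  by simp_all

section \<open>Printing constants and multiplying counters\<close>

definition emit :: "bool \<Rightarrow> cmd" where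
  "emit b = Seq (Go 5 Right) (Out b)"

definition emits :: "bool list \<Rightarrow> cmd" where
  "emits w = foldr (\<lambda>b. Seq (emit b)) w Skip"

lemma contents_of_snoc:
  "contents_of (w @ [b]) = (contents_of w)(Suc (length w) := if b then 3 else 2)"
  by (rule ext) (auto simp: contents_of_def nth_append)

lemma exec_emit:
  "exec (emit b) (tapes x h k1 k2 k3 k4 out) (tapes x h k1 k2 k3 k4 (out @ [b])) 3"
proof -
  let ?ts = "tapes x h k1 k2 k3 k4 out"
  have "exec (Go 5 Right) ?ts (?ts[5 := (Suc (length out), contents_of out)]) 1"
    using exec_Go[of 5 ?ts Right] by (simp add: tapes_def)
  moreover have "exec (Out b) (?ts[5 := (Suc (length out), contents_of out)])
      (tapes x h k1 k2 k3 k4 (out @ [b])) 1"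
    using exec_Out[of "?ts[5 := (Suc (length out), contents_of out)]" b]
    by (simp add: tapes_def contents_of_snoc numeral_eq_Suc)
  ultimately show ?thesis
    unfolding emit_def by (rule exec_mono[OF exec_Seq]) simp
qed

lemma exec_emits:
  "exec (emits w) (tapes x h k1 k2 k3 k4 out) (tapes x h k1 k2 k3 k4 (out @ w))
     (4 * length w + 1)"
proof (induction w arbitrary: out)
  case Nil
  then show ?case
    using exec_Skip by (simp add: emits_def)
next
  case (Cons b w)
  have "exec (Seq (emit b) (emits w)) (tapes x h k1 k2 k3 k4 out)
      (tapes x h k1 k2 k3 k4 (out @ b # w)) (3 + (4 * length w + 1) + 1)"
    using exec_Seq[OF exec_emit Cons.IH[of "out @ [b]"]] by simp
  then show ?case
    by (simp add: emits_def)
qed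


lemma contents_of_Nil: "contents_of [] i = (if i = 0 then 1 else 0)"
  by (simp add: contents_of_def)

text \<open>Tape 4 accumulates the product of the counters on tapes 1 and 3. Adding the counter on
  tape 1 destroys it, so tape 2 keeps a copy from which it is restored. The product finally moves to
  tape 3, where the next multiplication finds its factor.\<close>

definition multiply :: cmd where
  "multiply =
     Seq (While 3 1
           (Seq (Go 3 Left)
             (Seq (While 1 1 (Seq (Go 4 Right) (Seq (Go 1 Left) (Go 2 Right))))
               (While 2 1 (Seq (Go 2 Left) (Go 1 Right))))))
         (While 4 1 (Seq (Go 4 Left) (Go 3 Right)))"

lemma exec_multiply:
  "exec multiply (tapes x h N 0 c 0 out) (tapes x h N 0 (c * N) 0 out) ((c + 1) * (14 * N + 6))"
proof -
  have add: "exec (While 1 1 (Seq (Go 4 Right) (Seq (Go 1 Left) (Go 2 Right))))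
      (tapes x h N 0 k3 k4 out) (tapes x h 0 N k3 (k4 + N) out) (N * 6 + 1)" for k3 k4
  proof -
    define F where "F v = tapes x h v (N - v) k3 (k4 + (N - v)) out" for v
    have "exec (Seq (Go 4 Right) (Seq (Go 1 Left) (Go 2 Right))) (F (Suc v)) (F v) 5"
      if "v < N" for v
    proof -
      have "N - v = Suc (N - Suc v)"
        using that by simp
      then show ?thesis
        using exec_Seq[OF exec_Go_tapes(5) exec_Seq[OF exec_Go_tapes(2) exec_Go_tapes(3)],
            of Right Left Right x h "Suc v" "N - Suc v" k3 "k4 + (N - Suc v)" out]
        by (simp add: F_def numeral_eq_Suc)
    qed
    then have "exec (While 1 1 (Seq (Go 4 Right) (Seq (Go 1 Left) (Go 2 Right)))) (F N) (F 0)
        (N * (5 + 1) + 1)"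
      by (intro exec_countdown) (auto simp: F_def contents_of_Nil)
    then show ?thesis
      by (simp add: F_def)
  qed
  have restore: "exec (While 2 1 (Seq (Go 2 Left) (Go 1 Right)))
      (tapes x h 0 N k3 k4 out) (tapes x h N 0 k3 k4 out) (N * 4 + 1)" for k3 k4
  proof -
    define F where "F v = tapes x h (N - v) v k3 k4 out" for v
    have "exec (Seq (Go 2 Left) (Go 1 Right)) (F (Suc v)) (F v) 3" if "v < N" for v
    proof -
      have "N - v = Suc (N - Suc v)"
        using that by simp
      then show ?thesis
        using exec_Seq[OF exec_Go_tapes(3) exec_Go_tapes(2),
            of Left Right x h "N - Suc v" "Suc v" k3 k4 out]
        by (simp add: F_def numeral_eq_Suc)
    qed
    then have "exec (While 2 1 (Seq (Go 2 Left) (Go 1 Right))) (F N) (F 0) (N * (3 + 1) + 1)"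
      by (intro exec_countdown) (auto simp: F_def contents_of_Nil)
    then show ?thesis
      by (simp add: F_def)
  qed
  let ?body = "Seq (Go 3 Left)
      (Seq (While 1 1 (Seq (Go 4 Right) (Seq (Go 1 Left) (Go 2 Right))))
        (While 2 1 (Seq (Go 2 Left) (Go 1 Right))))"
  have outer: "exec (While 3 1 ?body) (tapes x h N 0 c 0 out) (tapes x h N 0 0 (c * N) out)
      (c * (N * 10 + 6) + 1)"
  proof -
    define F where "F v = tapes x h N 0 v ((c - v) * N) out" for v
    have "exec ?body (F (Suc v)) (F v) (N * 10 + 5)" if "v < c" for v
    proof -
      have "c - v = Suc (c - Suc v)"
        using that by simp
      then have "F v = tapes x h N 0 v ((c - Suc v) * N + N) out"
        by (simp add: F_def add.commute)
      moreover have "F (Suc v) = tapes x h N 0 (Suc v) ((c - Suc v) * N) out"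
        by (simp add: F_def)
      ultimately show ?thesis
        using exec_Seq[OF exec_Go_tapes(4) exec_Seq[OF add restore],
            of Left "Suc v" "(c - Suc v) * N"]
        by (auto intro: exec_mono)
    qed
    then have "exec (While 3 1 ?body) (F c) (F 0) (c * ((N * 10 + 5) + 1) + 1)"
      by (intro exec_countdown) (auto simp: F_def contents_of_Nil)
    then show ?thesis
      by (simp add: F_def add.commute)
  qed
  have final: "exec (While 4 1 (Seq (Go 4 Left) (Go 3 Right)))
      (tapes x h N 0 0 (c * N) out) (tapes x h N 0 (c * N) 0 out) (c * N * 4 + 1)"
  proof -
    define F where "F v = tapes x h N 0 (c * N - v) v out" for v
    have "exec (Seq (Go 4 Left) (Go 3 Right)) (F (Suc v)) (F v) 3" if "v < c * N" for v
    proof -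
      have "c * N - v = Suc (c * N - Suc v)"
        using that by simp
      then show ?thesis
        using exec_Seq[OF exec_Go_tapes(5) exec_Go_tapes(4),
            of Left Right x h N 0 "c * N - Suc v" "Suc v" out]
        by (simp add: F_def numeral_eq_Suc)
    qed
    then have "exec (While 4 1 (Seq (Go 4 Left) (Go 3 Right))) (F (c * N)) (F 0)
        (c * N * (3 + 1) + 1)"
      by (intro exec_countdown) (auto simp: F_def contents_of_Nil)
    then show ?thesis
      by (simp add: F_def)
  qed
  show ?thesis
    unfolding multiply_def
    by (rule exec_mono[OF exec_Seq[OF outer final]]) (simp add: algebra_simps)
qed

section \<open>Emitting formula schemas\<close>

primrec subst :: "('a \<Rightarrow> 'b ltlf) \<Rightarrow> 'a ltlf \<Rightarrow> 'b ltlf" where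
  "subst \<sigma> (Prop p) = \<sigma> p"
| "subst \<sigma> (Neg \<phi>) = Neg (subst \<sigma> \<phi>)"
| "subst \<sigma> (Conj \<phi> \<psi>) = Conj (subst \<sigma> \<phi>) (subst \<sigma> \<psi>)"
| "subst \<sigma> (Next \<phi>) = Next (subst \<sigma> \<phi>)"
| "subst \<sigma> (Until \<phi> \<psi>) = Until (subst \<sigma> \<phi>) (subst \<sigma> \<psi>)"

text \<open>The syntax has no constant for truth; a tautology over a formula at hand introduces no
  new atom.\<close>

definition tt :: "'a ltlf \<Rightarrow> 'a ltlf" where
  "tt \<phi> = Neg (Conj \<phi> (Neg \<phi>))"

text \<open>Atoms of a schema: \<open>All F\<close> stands for a conjunction over all bit positions \<open>b < m\<close>, where
  the atom \<open>(k, e)\<close> of \<open>F\<close> denotes bit \<open>b + e\<close> of the family \<open>k\<close>; bit \<open>b\<close> of the family \<open>k\<close>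
  is the atom with number \<open>b * C + idx k\<close>.\<close>

datatype 'k satom = One 'k | All "('k \<times> nat) ltlf"

text \<open>\<open>One k\<close> is bit 0 of the family \<open>k\<close>, so single propositions and
  binary numbers share one numbering of the atoms.\<close>

primrec ground :: "nat \<Rightarrow> ('k \<Rightarrow> nat) \<Rightarrow> nat \<Rightarrow> 'k satom \<Rightarrow> nat ltlf" where
  "ground C idx m (One k) = Prop (idx k)"
| "ground C idx m (All F) =
     foldr (\<lambda>b. Conj (map_ltlf (\<lambda>(k, e). (b + e) * C + idx k) F)) [0..<m] (tt (Prop 0))"

text \<open>Indices are unary, so the variable part \<open>b * C\<close> is printed in
  \<open>b\<close> rounds of \<open>C\<close> ones, with tape 2 saving \<open>b\<close>. The
  remaining part of an index is a constant of the program, printed by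
  \<open>emit_body\<close>.\<close>

definition emit_index :: "nat \<Rightarrow> cmd" where
  "emit_index C =
     Seq (While 4 1 (Seq (emits (replicate C True)) (Seq (Go 4 Left) (Go 2 Right))))
         (While 2 1 (Seq (Go 2 Left) (Go 4 Right)))"

lemma exec_emit_index:
  "exec (emit_index C) (tapes x h N 0 c b out)
     (tapes x h N 0 c b (out @ replicate (b * C) True)) ((4 * C + 13) * (b + 1))"
proof -
  let ?body = "Seq (emits (replicate C True)) (Seq (Go 4 Left) (Go 2 Right))"
  have emit: "exec (While 4 1 ?body) (tapes x h N 0 c b out)
      (tapes x h N b c 0 (out @ replicate (b * C) True)) (b * (4 * C + 6) + 1)"
  proof -
    define F where "F v = tapes x h N (b - v) c v (out @ replicate ((b - v) * C) True)" for v
    have "exec ?body (F (Suc v)) (F v) (4 * C + 5)" if "v < b" for v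
    proof -
      have "b - v = Suc (b - Suc v)"
        using that by simp
      moreover from this
      have "replicate ((b - v) * C) True = replicate ((b - Suc v) * C) True @ replicate C True"
        by (simp add: replicate_add[symmetric] add.commute)
      ultimately show ?thesis
        using exec_Seq[OF exec_emits exec_Seq[OF exec_Go_tapes(5) exec_Go_tapes(3)],
            of "replicate C True" Left Right x h N "b - Suc v" c "Suc v"
            "out @ replicate ((b - Suc v) * C) True"]
        by (simp add: F_def numeral_eq_Suc)
    qed
    then have "exec (While 4 1 ?body) (F b) (F 0) (b * ((4 * C + 5) + 1) + 1)"
      by (intro exec_countdown) (auto simp: F_def contents_of_Nil)
    then show ?thesis
      by (simp add: F_def add.commute)
  qed
  have restore: "exec (While 2 1 (Seq (Go 2 Left) (Go 4 Right)))
      (tapes x h N b c 0 out) (tapes x h N 0 c b out) (b * 4 + 1)" for out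
  proof -
    define F where "F v = tapes x h N v c (b - v) out" for v
    have "exec (Seq (Go 2 Left) (Go 4 Right)) (F (Suc v)) (F v) 3" if "v < b" for v
    proof -
      have "b - v = Suc (b - Suc v)"
        using that by simp
      then show ?thesis
        using exec_Seq[OF exec_Go_tapes(3) exec_Go_tapes(5),
            of Left Right x h N "Suc v" c "b - Suc v" out]
        by (simp add: F_def numeral_eq_Suc)
    qed
    then have "exec (While 2 1 (Seq (Go 2 Left) (Go 4 Right))) (F b) (F 0) (b * (3 + 1) + 1)"
      by (intro exec_countdown) (auto simp: F_def contents_of_Nil)
    then show ?thesis
      by (simp add: F_def)
  qed
  show ?thesis
    unfolding emit_index_def
    by (rule exec_mono[OF exec_Seq[OF emit restore]]) (simp add: algebra_simps)
qed

primrec emit_body :: "nat \<Rightarrow> ('k \<Rightarrow> nat) \<Rightarrow> ('k \<times> nat) ltlf \<Rightarrow> cmd" where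
  "emit_body C idx (Prop p) =
     Seq (emits [False, False, False])
       (Seq (emit_index C) (emits (replicate (snd p * C + idx (fst p)) True @ [False])))"
| "emit_body C idx (Neg F) = Seq (emits [False, False, True]) (emit_body C idx F)"
| "emit_body C idx (Conj F G) =
     Seq (emits [False, True, False]) (Seq (emit_body C idx F) (emit_body C idx G))"
| "emit_body C idx (Next F) = Seq (emits [False, True, True]) (emit_body C idx F)"
| "emit_body C idx (Until F G) =
     Seq (emits [True, False, False]) (Seq (emit_body C idx F) (emit_body C idx G))"

text \<open>The factor \<open>A\<close> depends on the fixed schema only: \<open>b\<close>
  influences the running time through the unary indices alone, hence linearly.\<close>

lemma exec_emit_body:
  "\<exists>A. \<forall>x h N c b out. exec (emit_body C idx F) (tapes x h N 0 c b out)
     (tapes x h N 0 c b (out @ encode (map_ltlf (\<lambda>(k, e). (b + e) * C + idx k) F)))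
     (A * (b + 1))"
proof (induction F)
  case (Prop p)
  obtain k e where p: "p = (k, e)"
    by (cases p)
  define w where "w = replicate (e * C + idx k) True @ [False]"
  have enc: "out @ encode (map_ltlf (\<lambda>(k, e). (b + e) * C + idx k) (Prop p))
      = ((out @ [False, False, False]) @ replicate (b * C) True) @ w" for b out
    by (simp add: p w_def add_mult_distrib add.assoc replicate_add)
  have prog: "emit_body C idx (Prop p)
      = Seq (emits [False, False, False]) (Seq (emit_index C) (emits w))"
    by (simp add: p w_def)
  have "exec (emit_body C idx (Prop p)) (tapes x h N 0 c b out)
     (tapes x h N 0 c b (out @ encode (map_ltlf (\<lambda>(k, e). (b + e) * C + idx k) (Prop p))))
     ((4 * C + 4 * length w + 30) * (b + 1))" for x h N c b out
    unfolding enc prog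
    by (rule exec_mono[OF exec_Seq[OF exec_emits exec_Seq[OF exec_emit_index exec_emits]]])
      (simp add: algebra_simps)
  then show ?case
    by blast
next
  case (Neg F)
  then obtain A where A: "\<And>x h N c b out. exec (emit_body C idx F) (tapes x h N 0 c b out)
     (tapes x h N 0 c b (out @ encode (map_ltlf (\<lambda>(k, e). (b + e) * C + idx k) F)))
     (A * (b + 1))"
    by blast
  have "exec (emit_body C idx (Neg F)) (tapes x h N 0 c b out)
     (tapes x h N 0 c b (out @ encode (map_ltlf (\<lambda>(k, e). (b + e) * C + idx k) (Neg F))))
     ((A + 14) * (b + 1))" for x h N c b out
    using exec_mono[OF exec_Seq[OF exec_emits A], of "[False, False, True]" b "(A + 14) * (b + 1)"]
    by simp
  then show ?case
    by blast
next
  case (Next F)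
  then obtain A where A: "\<And>x h N c b out. exec (emit_body C idx F) (tapes x h N 0 c b out)
     (tapes x h N 0 c b (out @ encode (map_ltlf (\<lambda>(k, e). (b + e) * C + idx k) F)))
     (A * (b + 1))"
    by blast
  have "exec (emit_body C idx (Next F)) (tapes x h N 0 c b out)
     (tapes x h N 0 c b (out @ encode (map_ltlf (\<lambda>(k, e). (b + e) * C + idx k) (Next F))))
     ((A + 14) * (b + 1))" for x h N c b out
    using exec_mono[OF exec_Seq[OF exec_emits A], of "[False, True, True]" b "(A + 14) * (b + 1)"]
    by simp
  then show ?case
    by blast
next
  case (Conj F G)
  then obtain A B where A: "\<And>x h N c b out. exec (emit_body C idx F) (tapes x h N 0 c b out)
     (tapes x h N 0 c b (out @ encode (map_ltlf (\<lambda>(k, e). (b + e) * C + idx k) F)))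
     (A * (b + 1))"
   and B: "\<And>x h N c b out. exec (emit_body C idx G) (tapes x h N 0 c b out)
     (tapes x h N 0 c b (out @ encode (map_ltlf (\<lambda>(k, e). (b + e) * C + idx k) G)))
     (B * (b + 1))"
    by blast
  have "exec (emit_body C idx (Conj F G)) (tapes x h N 0 c b out)
     (tapes x h N 0 c b (out @ encode (map_ltlf (\<lambda>(k, e). (b + e) * C + idx k) (Conj F G))))
     ((A + B + 15) * (b + 1))" for x h N c b out
    using exec_mono[OF exec_Seq[OF exec_emits exec_Seq[OF A B]],
        of "[False, True, False]" b "(A + B + 15) * (b + 1)"]
    by (simp add: algebra_simps)
  then show ?case
    by blast
next
  case (Until F G)
  then obtain A B where A: "\<And>x h N c b out. exec (emit_body C idx F) (tapes x h N 0 c b out)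
     (tapes x h N 0 c b (out @ encode (map_ltlf (\<lambda>(k, e). (b + e) * C + idx k) F)))
     (A * (b + 1))"
   and B: "\<And>x h N c b out. exec (emit_body C idx G) (tapes x h N 0 c b out)
     (tapes x h N 0 c b (out @ encode (map_ltlf (\<lambda>(k, e). (b + e) * C + idx k) G)))
     (B * (b + 1))"
    by blast
  have "exec (emit_body C idx (Until F G)) (tapes x h N 0 c b out)
     (tapes x h N 0 c b (out @ encode (map_ltlf (\<lambda>(k, e). (b + e) * C + idx k) (Until F G))))
     ((A + B + 15) * (b + 1))" for x h N c b out
    using exec_mono[OF exec_Seq[OF exec_emits exec_Seq[OF A B]],
        of "[True, False, False]" b "(A + B + 15) * (b + 1)"]
    by (simp add: algebra_simps)
  then show ?case
    by blast
qed

text \<open>Tape 3 counts the conjuncts still to be printed and tape 4 the current bit position;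
  their sum stays \<open>m\<close>, so moving tape 4 back to tape 3 recovers \<open>m\<close> for
  the next occurrence of \<open>All\<close>.\<close>

definition emit_all :: "nat \<Rightarrow> ('k \<Rightarrow> nat) \<Rightarrow> ('k \<times> nat) ltlf \<Rightarrow> cmd" where
  "emit_all C idx F =
     Seq (While 3 1 (Seq (emits [False, True, False])
           (Seq (emit_body C idx F) (Seq (Go 3 Left) (Go 4 Right)))))
       (Seq (While 4 1 (Seq (Go 4 Left) (Go 3 Right))) (emits (encode (tt (Prop (0::nat))))))"

text \<open>In Polish notation a right-nested conjunction is a concatenation of blocks without
  closing brackets, so a loop prints it without keeping track of the nesting.\<close>

lemma encode_foldr_Conj:
  "encode (foldr (\<lambda>b. Conj (f b)) bs \<phi>)
     = concat (map (\<lambda>b. [False, True, False] @ encode (f b)) bs) @ encode \<phi>"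
  by (induction bs) simp_all

lemma exec_emit_all:
  "\<exists>A. \<forall>x h N m out. exec (emit_all C idx F) (tapes x h N 0 m 0 out)
     (tapes x h N 0 m 0 (out @ encode (ground C idx m (All F)))) (A * (m + 1)\<^sup>2)"
proof -
  obtain A where A: "\<And>x h N c b out. exec (emit_body C idx F) (tapes x h N 0 c b out)
     (tapes x h N 0 c b (out @ encode (map_ltlf (\<lambda>(k, e). (b + e) * C + idx k) F)))
     (A * (b + 1))"
    using exec_emit_body[of C idx F] by blast
  define f where "f b = [False, True, False] @ encode (map_ltlf (\<lambda>(k, e). (b + e) * C + idx k) F)"
    for b
  define u where "u = encode (tt (Prop (0::nat)))"
  let ?body = "Seq (emits [False, True, False])
      (Seq (emit_body C idx F) (Seq (Go 3 Left) (Go 4 Right)))"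
  have emit: "exec (While 3 1 ?body) (tapes x h N 0 m 0 out)
      (tapes x h N 0 0 m (out @ concat (map f [0..<m]))) (m * (A * (m + 1) + 19) + 1)"
    for x h N m out
  proof -
    define G where "G v = tapes x h N 0 v (m - v) (out @ concat (map f [0..<m - v]))" for v
    have "exec ?body (G (Suc v)) (G v) (A * (m + 1) + 18)" if "v < m" for v
    proof -
      have v: "m - v = Suc (m - Suc v)"
        using that by simp
      have G: "G v = tapes x h N 0 v (Suc (m - Suc v))
          (((out @ concat (map f [0..<m - Suc v])) @ [False, True, False]) @
            encode (map_ltlf (\<lambda>(k, e). ((m - Suc v) + e) * C + idx k) F))"
        by (simp add: G_def v f_def)
      have "exec ?body (G (Suc v)) (G v) (13 + (A * ((m - Suc v) + 1) + 3 + 1) + 1)"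
        unfolding G
        using exec_Seq[OF exec_emits exec_Seq[OF A exec_Seq[OF exec_Go_tapes(4) exec_Go_tapes(5)]],
            of "[False, True, False]" Left Right x h N "Suc v" "m - Suc v"
            "out @ concat (map f [0..<m - Suc v])"]
        by (simp add: G_def numeral_eq_Suc)
      moreover have "A * ((m - Suc v) + 1) \<le> A * (m + 1)"
        by (rule mult_le_mono2) simp
      ultimately show ?thesis
        by (elim exec_mono) simp
    qed
    then have "exec (While 3 1 ?body) (G m) (G 0) (m * ((A * (m + 1) + 18) + 1) + 1)"
      by (intro exec_countdown) (auto simp: G_def contents_of_Nil)
    then have "exec (While 3 1 ?body) (G m) (G 0) (m * (A * (m + 1) + 19) + 1)"
      by (rule exec_mono) simp
    moreover have "G m = tapes x h N 0 m 0 out"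
      "G 0 = tapes x h N 0 0 m (out @ concat (map f [0..<m]))"
      by (simp_all add: G_def)
    ultimately show ?thesis
      by (simp only:)
  qed
  have restore: "exec (While 4 1 (Seq (Go 4 Left) (Go 3 Right)))
      (tapes x h N 0 0 m out) (tapes x h N 0 m 0 out) (m * 4 + 1)" for x h N m out
  proof -
    define G where "G v = tapes x h N 0 (m - v) v out" for v
    have "exec (Seq (Go 4 Left) (Go 3 Right)) (G (Suc v)) (G v) 3" if "v < m" for v
    proof -
      have "m - v = Suc (m - Suc v)"
        using that by simp
      then show ?thesis
        using exec_Seq[OF exec_Go_tapes(5) exec_Go_tapes(4),
            of Left Right x h N 0 "m - Suc v" "Suc v" out]
        by (simp add: G_def numeral_eq_Suc)
    qed
    then have "exec (While 4 1 (Seq (Go 4 Left) (Go 3 Right))) (G m) (G 0) (m * (3 + 1) + 1)"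
      by (intro exec_countdown) (auto simp: G_def contents_of_Nil)
    then show ?thesis
      by (simp add: G_def)
  qed
  have "exec (emit_all C idx F) (tapes x h N 0 m 0 out)
     (tapes x h N 0 m 0 (out @ encode (ground C idx m (All F))))
     ((A + 4 * length u + 28) * (m + 1)\<^sup>2)" for x h N m out
  proof -
    have "out @ encode (ground C idx m (All F)) = (out @ concat (map f [0..<m])) @ u"
      by (simp add: encode_foldr_Conj f_def[abs_def] u_def)
    moreover have "emit_all C idx F
        = Seq (While 3 1 ?body) (Seq (While 4 1 (Seq (Go 4 Left) (Go 3 Right))) (emits u))"
      by (simp add: emit_all_def u_def)
    ultimately show ?thesis
      by (simp only:)
        (rule exec_mono[OF exec_Seq[OF emit exec_Seq[OF restore exec_emits]]],
          simp add: algebra_simps power2_eq_square)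
  qed
  then show ?thesis
    by blast
qed

primrec emit_schema :: "nat \<Rightarrow> ('k \<Rightarrow> nat) \<Rightarrow> 'k satom ltlf \<Rightarrow> cmd" where
  "emit_schema C idx (Prop p) =
     (case p of One k \<Rightarrow> emits (encode (Prop (idx k))) | All F \<Rightarrow> emit_all C idx F)"
| "emit_schema C idx (Neg F) = Seq (emits [False, False, True]) (emit_schema C idx F)"
| "emit_schema C idx (Conj F G) =
     Seq (emits [False, True, False]) (Seq (emit_schema C idx F) (emit_schema C idx G))"
| "emit_schema C idx (Next F) = Seq (emits [False, True, True]) (emit_schema C idx F)"
| "emit_schema C idx (Until F G) =
     Seq (emits [True, False, False]) (Seq (emit_schema C idx F) (emit_schema C idx G))"

lemma exec_emit_schema:
  "\<exists>A. \<forall>x h N m out. exec (emit_schema C idx \<phi>) (tapes x h N 0 m 0 out)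
     (tapes x h N 0 m 0 (out @ encode (subst (ground C idx m) \<phi>))) (A * (m + 1)\<^sup>2)"
proof (induction \<phi>)
  case (Prop p)
  show ?case
  proof (cases p)
    case (One k)
    let ?w = "encode (Prop (idx k))"
    have "exec (emit_schema C idx (Prop p)) (tapes x h N 0 m 0 out)
     (tapes x h N 0 m 0 (out @ encode (subst (ground C idx m) (Prop p))))
     ((4 * length ?w + 1) * (m + 1)\<^sup>2)" for x h N m out
      unfolding One emit_schema.simps satom.case subst.simps ground.simps
      by (rule exec_mono[OF exec_emits]) (use mult_le_mono2[of 1 "(m + 1)\<^sup>2"] in simp)
    then show ?thesis
      by blast
  next
    case (All F)
    then show ?thesis
      using exec_emit_all[of C idx F] by simp
  qed
next
  case (Neg F)
  then obtain A where A: "\<And>x h N m out. exec (emit_schema C idx F) (tapes x h N 0 m 0 out)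
     (tapes x h N 0 m 0 (out @ encode (subst (ground C idx m) F))) (A * (m + 1)\<^sup>2)"
    by blast
  have "exec (emit_schema C idx (Neg F)) (tapes x h N 0 m 0 out)
     (tapes x h N 0 m 0 (out @ encode (subst (ground C idx m) (Neg F))))
     ((A + 14) * (m + 1)\<^sup>2)" for x h N m out
    using exec_mono[OF exec_Seq[OF exec_emits A], of "[False, False, True]" m "(A + 14) * (m + 1)\<^sup>2"]
    by (simp add: power2_eq_square)
  then show ?case
    by blast
next
  case (Next F)
  then obtain A where A: "\<And>x h N m out. exec (emit_schema C idx F) (tapes x h N 0 m 0 out)
     (tapes x h N 0 m 0 (out @ encode (subst (ground C idx m) F))) (A * (m + 1)\<^sup>2)"
    by blast
  have "exec (emit_schema C idx (Next F)) (tapes x h N 0 m 0 out)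
     (tapes x h N 0 m 0 (out @ encode (subst (ground C idx m) (Next F))))
     ((A + 14) * (m + 1)\<^sup>2)" for x h N m out
    using exec_mono[OF exec_Seq[OF exec_emits A], of "[False, True, True]" m "(A + 14) * (m + 1)\<^sup>2"]
    by (simp add: power2_eq_square)
  then show ?case
    by blast
next
  case (Conj F G)
  then obtain A B where A: "\<And>x h N m out. exec (emit_schema C idx F) (tapes x h N 0 m 0 out)
     (tapes x h N 0 m 0 (out @ encode (subst (ground C idx m) F))) (A * (m + 1)\<^sup>2)"
   and B: "\<And>x h N m out. exec (emit_schema C idx G) (tapes x h N 0 m 0 out)
     (tapes x h N 0 m 0 (out @ encode (subst (ground C idx m) G))) (B * (m + 1)\<^sup>2)"
    by blast
  have "exec (emit_schema C idx (Conj F G)) (tapes x h N 0 m 0 out)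
     (tapes x h N 0 m 0 (out @ encode (subst (ground C idx m) (Conj F G))))
     ((A + B + 15) * (m + 1)\<^sup>2)" for x h N m out
    using exec_mono[OF exec_Seq[OF exec_emits exec_Seq[OF A B]],
        of "[False, True, False]" m "(A + B + 15) * (m + 1)\<^sup>2"]
    by (simp add: algebra_simps power2_eq_square)
  then show ?case
    by blast
next
  case (Until F G)
  then obtain A B where A: "\<And>x h N m out. exec (emit_schema C idx F) (tapes x h N 0 m 0 out)
     (tapes x h N 0 m 0 (out @ encode (subst (ground C idx m) F))) (A * (m + 1)\<^sup>2)"
   and B: "\<And>x h N m out. exec (emit_schema C idx G) (tapes x h N 0 m 0 out)
     (tapes x h N 0 m 0 (out @ encode (subst (ground C idx m) G))) (B * (m + 1)\<^sup>2)"
    by blast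
  have "exec (emit_schema C idx (Until F G)) (tapes x h N 0 m 0 out)
     (tapes x h N 0 m 0 (out @ encode (subst (ground C idx m) (Until F G))))
     ((A + B + 15) * (m + 1)\<^sup>2)" for x h N m out
    using exec_mono[OF exec_Seq[OF exec_emits exec_Seq[OF A B]],
        of "[True, False, False]" m "(A + B + 15) * (m + 1)\<^sup>2"]
    by (simp add: algebra_simps power2_eq_square)
  then show ?case
    by blast
qed

text \<open>One scan both prints a block for every input bit and counts the length on tape 1, where
  it later serves as the base of a power. The first move skips the marker; the blank behind the
  input ends the loop.\<close>

definition emit_input :: "(bool \<Rightarrow> bool list) \<Rightarrow> cmd" where
  "emit_input g = Seq (Go 0 Right)
     (While 0 0 (Seq (IfSym 0 3 (emits (g True)) (emits (g False)))
       (Seq (Go 1 Right) (Go 0 Right))))"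

lemma exec_emit_input:
  "\<exists>h. exec (emit_input g) (tapes x 0 0 0 0 0 out)
     (tapes x h (length x) 0 0 0 (out @ concat (map g x)))
     ((4 * length (g True) + 4 * length (g False) + 10) * (length x + 1))"
proof -
  let ?body = "Seq (IfSym 0 3 (emits (g True)) (emits (g False))) (Seq (Go 1 Right) (Go 0 Right))"
  let ?T = "4 * length (g True) + 4 * length (g False) + 6"
  define n where "n = length x"
  define F where "F v = tapes x (n + 1 - v) (n - v) 0 0 0 (out @ concat (map g (take (n - v) x)))"
    for v
  have "exec ?body (F (Suc v)) (F v) ?T \<and> contents_of x (n - v) \<noteq> 0" if "v < n" for v
  proof -
    have v: "n - v = Suc (n - Suc v)" "Suc n - v = Suc (Suc (n - Suc v))" "n + 1 - Suc v = n - v"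
      using that by simp_all
    define b where "b = x ! (n - Suc v)"
    have len: "n - Suc v < length x"
      using that by (simp add: n_def)
    \<comment> \<open>The marker occupies cell 0, so bit \<open>n - Suc v\<close> of the input lies
      in cell \<open>n - v\<close>.\<close>
    have sym: "contents_of x (n - v) = (if b then 3 else 2)"
      using that by (auto simp: contents_of_def v(1) b_def n_def)
    have "exec (IfSym 0 3 (emits (g True)) (emits (g False))) (F (Suc v))
        (tapes x (n - v) (n - Suc v) 0 0 0 (out @ concat (map g (take (n - Suc v) x)) @ g b))
        (4 * length (g b) + 1 + 1)"
      by (rule exec_IfSym; use sym exec_emits[of "g b" x "n - v" "n - Suc v" 0 0 0
            "out @ concat (map g (take (n - Suc v) x))"] in \<open>cases b; simp add: F_def v(3)\<close>)
    moreover have "take (n - v) x = take (n - Suc v) x @ [b]"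
      unfolding v(1) b_def by (rule take_Suc_conv_app_nth[OF len])
    then have "exec (Seq (Go 1 Right) (Go 0 Right))
        (tapes x (n - v) (n - Suc v) 0 0 0 (out @ concat (map g (take (n - Suc v) x)) @ g b))
        (F v) 3"
      using exec_Seq[OF exec_Go_tapes(2) exec_Go_tapes(1),
          of Right Right x "n - v" "n - Suc v" 0 0 0
          "out @ concat (map g (take (n - Suc v) x)) @ g b"]
      by (simp add: F_def v numeral_eq_Suc)
    ultimately have "exec ?body (F (Suc v)) (F v) ((4 * length (g b) + 1 + 1) + 3 + 1)"
      by (rule exec_Seq)
    then show ?thesis
      using sym by (cases b) (auto elim: exec_mono)
  qed
  then have "exec (While 0 0 ?body) (F n) (F 0) (n * (?T + 1) + 1)"
    by (intro exec_countdown) (auto simp: F_def contents_of_def n_def)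
  moreover have "exec (Go 0 Right) (tapes x 0 0 0 0 0 out) (F n) 1"
    using exec_Go_tapes(1)[of Right x 0 0 0 0 0 out] by (simp add: F_def)
  ultimately have "exec (emit_input g) (tapes x 0 0 0 0 0 out) (F 0) (1 + (n * (?T + 1) + 1) + 1)"
    unfolding emit_input_def by (intro exec_Seq)
  then have "exec (emit_input g) (tapes x 0 0 0 0 0 out) (F 0)
      ((4 * length (g True) + 4 * length (g False) + 10) * (length x + 1))"
    by (rule exec_mono) (simp add: n_def algebra_simps)
  then show ?thesis
    unfolding F_def n_def by auto
qed

text \<open>The number of repetitions is a constant of the program, so it is unrolled and takes no
  counter.\<close>

definition repeat :: "nat \<Rightarrow> cmd \<Rightarrow> cmd" where
  "repeat k c = (Seq c ^^ k) Skip"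

lemma exec_repeat:
  assumes "\<And>i. i < k \<Longrightarrow> exec c (F i) (F (Suc i)) T"
  shows "exec (repeat k c) (F 0) (F k) (k * (T + 1) + 1)"
  using assms
proof (induction k arbitrary: F)
  case 0
  then show ?case
    using exec_Skip by (simp add: repeat_def)
next
  case (Suc k)
  have "exec (repeat k c) (F (Suc 0)) (F (Suc k)) (k * (T + 1) + 1)"
    using Suc.IH[of "\<lambda>i. F (Suc i)"] Suc.prems by simp
  then have "exec (Seq c (repeat k c)) (F 0) (F (Suc k)) (T + (k * (T + 1) + 1) + 1)"
    using Suc.prems[of 0] by (intro exec_Seq) simp_all
  then show ?case
    by (simp add: repeat_def algebra_simps)
qed

text \<open>\<open>Go 1 Right\<close> turns the length \<open>n\<close> into the base
  \<open>n + 1\<close>. Starting tape 3 at \<open>a\<close> and multiplying \<open>d\<close> times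
  yields the number of bits without evaluating a general polynomial.\<close>

definition program ::
  "bool list \<Rightarrow> (bool \<Rightarrow> bool list) \<Rightarrow> bool list \<Rightarrow> nat \<Rightarrow> nat \<Rightarrow> nat \<Rightarrow> ('k \<Rightarrow> nat) \<Rightarrow> 'k satom ltlf \<Rightarrow> cmd"
  where
  "program pre g post a d C idx \<phi> =
     Seq (emits pre) (Seq (emit_input g) (Seq (emits post) (Seq (Go 1 Right)
       (Seq (repeat a (Go 3 Right)) (Seq (repeat d multiply) (emit_schema C idx \<phi>))))))"

lemma exec_program:
  "\<exists>P :: nat poly. \<forall>x. \<exists>h. exec (program pre g post a d C idx \<phi>) (tapes x 0 0 0 0 0 [])
     (tapes x h (length x + 1) 0 (a * (length x + 1) ^ d) 0
       (pre @ concat (map g x) @ post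
         @ encode (subst (ground C idx (a * (length x + 1) ^ d)) \<phi>)))
     (poly P (length x))"
proof -
  obtain A where A: "\<And>x h N m out. exec (emit_schema C idx \<phi>) (tapes x h N 0 m 0 out)
     (tapes x h N 0 m 0 (out @ encode (subst (ground C idx m) \<phi>))) (A * (m + 1)\<^sup>2)"
    using exec_emit_schema[of C idx \<phi>] by blast
  define N :: "nat poly" where "N = [:1, 1:]"
  define Mx :: "nat poly" where "Mx = [:a:] * N ^ d"
  have poly_N: "poly N n = n + 1" for n
    by (simp add: N_def)
  have poly_Mx: "poly Mx n = a * (n + 1) ^ d" for n
    by (simp add: Mx_def poly_N poly_power)
  \<comment> \<open>The summands follow the nesting of \<open>Seq\<close> in \<open>program\<close>,
    with a 1 for the step that each \<open>Seq\<close> costs.\<close>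
  define P where "P = [:4 * length pre + 1:]
     + ([:4 * length (g True) + 4 * length (g False) + 10:] * N
     + ([:4 * length post + 1:] + (1 + ([:a * 2 + 1:]
     + (([:d:] * ((Mx + 1) * ([:14:] * N + [:6:]) + 1) + 1)
     + [:A:] * (Mx + 1)^2 + 1) + 1) + 1) + 1) + 1) + 1"
  have "\<exists>h. exec (program pre g post a d C idx \<phi>) (tapes x 0 0 0 0 0 [])
     (tapes x h (length x + 1) 0 (a * (length x + 1) ^ d) 0
       (pre @ concat (map g x) @ post
         @ encode (subst (ground C idx (a * (length x + 1) ^ d)) \<phi>)))
     (poly P (length x))" for x
  proof -
    define n where "n = length x"
    obtain h where input: "exec (emit_input g) (tapes x 0 0 0 0 0 pre)
       (tapes x h n 0 0 0 (pre @ concat (map g x)))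
       ((4 * length (g True) + 4 * length (g False) + 10) * (n + 1))"
      using exec_emit_input unfolding n_def by blast
    let ?out = "(pre @ concat (map g x)) @ post"
    have go: "exec (Go 1 Right) (tapes x h n 0 0 0 ?out) (tapes x h (n + 1) 0 0 0 ?out) 1"
      using exec_Go_tapes(2)[of Right x h n 0 0 0 ?out] by simp
    have "exec (repeat a (Go 3 Right)) (tapes x h (n + 1) 0 0 0 ?out)
        (tapes x h (n + 1) 0 a 0 ?out) (a * (1 + 1) + 1)"
      using exec_Go_tapes(4)[of Right x h "n + 1" 0 _ 0 ?out]
      by (intro exec_repeat[where F = "\<lambda>i. tapes x h (n + 1) 0 i 0 ?out"]) simp
    then have init: "exec (repeat a (Go 3 Right)) (tapes x h (n + 1) 0 0 0 ?out)
        (tapes x h (n + 1) 0 (a * (n + 1) ^ 0) 0 ?out) (a * 2 + 1)"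
      by (simp add: numeral_eq_Suc)
    have "exec multiply (tapes x h (n + 1) 0 (a * (n + 1) ^ i) 0 ?out)
        (tapes x h (n + 1) 0 (a * (n + 1) ^ Suc i) 0 ?out)
        ((a * (n + 1) ^ d + 1) * (14 * (n + 1) + 6))" if "i < d" for i
    proof -
      have "a * (n + 1) ^ i * (n + 1) = a * (n + 1) ^ Suc i"
        by (simp only: power_Suc2 mult.assoc)
      then have "exec multiply (tapes x h (n + 1) 0 (a * (n + 1) ^ i) 0 ?out)
          (tapes x h (n + 1) 0 (a * (n + 1) ^ Suc i) 0 ?out)
          ((a * (n + 1) ^ i + 1) * (14 * (n + 1) + 6))"
        using exec_multiply[of x h "n + 1" "a * (n + 1) ^ i" ?out] by metis
      \<comment> \<open>Every multiplication is charged the cost bound belonging to the largest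
        power, which makes the bound uniform in \<open>i\<close>.\<close>
      moreover have "(n + 1) ^ i \<le> (n + 1) ^ d"
        using that by (intro power_increasing) simp_all
      then have "(a * (n + 1) ^ i + 1) * (14 * (n + 1) + 6)
          \<le> (a * (n + 1) ^ d + 1) * (14 * (n + 1) + 6)"
        by (intro mult_le_mono1 add_le_mono1 mult_le_mono2)
      ultimately show ?thesis
        by (rule exec_mono)
    qed
    then have mult: "exec (repeat d multiply) (tapes x h (n + 1) 0 (a * (n + 1) ^ 0) 0 ?out)
        (tapes x h (n + 1) 0 (a * (n + 1) ^ d) 0 ?out)
        (d * ((a * (n + 1) ^ d + 1) * (14 * (n + 1) + 6) + 1) + 1)"
      by (rule exec_repeat[where F = "\<lambda>i. tapes x h (n + 1) 0 (a * (n + 1) ^ i) 0 ?out"])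
    have "exec (emits pre) (tapes x 0 0 0 0 0 []) (tapes x 0 0 0 0 0 pre) (4 * length pre + 1)"
      using exec_emits[of pre x 0 0 0 0 0 "[]"] by simp
    from exec_Seq[OF this exec_Seq[OF input exec_Seq[OF exec_emits exec_Seq[OF go exec_Seq[OF init
              exec_Seq[OF mult A]]]]]]
    have "exec (program pre g post a d C idx \<phi>) (tapes x 0 0 0 0 0 [])
       (tapes x h (n + 1) 0 (a * (n + 1) ^ d) 0
         (?out @ encode (subst (ground C idx (a * (n + 1) ^ d)) \<phi>))) (poly P n)"
      unfolding program_def
      by (rule exec_mono) (simp add: P_def poly_N poly_Mx poly_power)
    then show ?thesis
      unfolding n_def append_assoc by blast
  qed
  then show ?thesis
    by blast
qed

section \<open>Compilation to Turing machines\<close>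

definition control_set :: "cmd \<Rightarrow> cmd list set" where
  "control_set c = insert [] (control_points c [])"

definition state_number :: "cmd \<Rightarrow> cmd list \<Rightarrow> nat" where
  "state_number c = (SOME f. bij_betw f (control_set c) {0..<card (control_set c)})"

lemma bij_betw_state_number: "bij_betw (state_number c) (control_set c) {0..<card (control_set c)}"
  unfolding state_number_def
  by (rule someI_ex[OF ex_bij_betw_finite_nat])
    (simp add: control_set_def finite_control_points)

text \<open>The empty stack is the accepting state. The rejecting state has to differ from it and
  receives the first number that belongs to no stack.\<close>

definition compile :: "cmd \<Rightarrow> tm" where
  "compile c =
     \<lparr>num_tapes = 6, num_states = card (control_set c) + 1, num_symbols = 4,
      start = state_number c [c], accept = state_number c [], reject = card (control_set c),
      delta = (\<lambda>q ss. if q < card (control_set c)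
        then (case cmd_delta (inv_into (control_set c) (state_number c) q) ss of
          (k, as) \<Rightarrow> (state_number c k, as))
        else (q, idle ss))\<rparr>"

lemma state_number_less: "k \<in> control_set c \<Longrightarrow> state_number c k < card (control_set c)"
  using bij_betw_state_number[of c] by (auto simp: bij_betw_def)

lemma cmd_delta_in_control_set:
  "k \<in> control_set c \<Longrightarrow> fst (cmd_delta k ss) \<in> control_set c"
  using control_points_closed[of k c "[]" ss] by (auto simp: control_set_def)

lemma state_number_inverse:
  "k \<in> control_set c \<Longrightarrow> inv_into (control_set c) (state_number c) (state_number c k) = k"
  using bij_betw_state_number[of c] by (simp add: bij_betw_def)

lemma inverse_in_control_set:
  "q < card (control_set c) \<Longrightarrow> inv_into (control_set c) (state_number c) q \<in> control_set c"
  using bij_betw_state_number[of c] by (simp add: bij_betw_def inv_into_into)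

lemma in_control_set: "[c] \<in> control_set c" "[] \<in> control_set c"
  by (simp_all add: control_set_def Cons_in_control_points)

lemma turing_machine_compile: "turing_machine (compile c)"
proof -
  have "case delta (compile c) q ss of (q', as) \<Rightarrow>
      q' < num_states (compile c) \<and> length as = num_tapes (compile c) \<and>
      fst ` set as \<subseteq> {..<num_symbols (compile c)}"
    if "q < num_states (compile c)" "length ss = num_tapes (compile c)"
      "set ss \<subseteq> {..<num_symbols (compile c)}" for q ss
  proof (cases "q < card (control_set c)")
    case True
    let ?k = "inv_into (control_set c) (state_number c) q"
    have "state_number c (fst (cmd_delta ?k ss)) < card (control_set c)"
      by (intro state_number_less cmd_delta_in_control_set inverse_in_control_set True)
    then show ?thesis
      using True that(2,3) length_cmd_delta[of ?k ss] symbols_cmd_delta[of ss ?k]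
      by (simp add: compile_def split_beta)
  next
    case False
    then show ?thesis
      using that by (auto simp: compile_def idle_def)
  qed
  moreover have "state_number c [c] < card (control_set c)" "state_number c [] < card (control_set c)"
    by (intro state_number_less in_control_set)+
  ultimately show ?thesis
    unfolding turing_machine_def by (simp add: compile_def)
qed

text \<open>Stacks are numbered injectively, so only the empty one gets the accepting number. There
  the machine halts while \<open>cmd_step\<close> idles, and the two agree after termination as
  well.\<close>

lemma step_compile:
  assumes "k \<in> control_set c"
  shows "step (compile c) (state_number c k, ts)
      = (state_number c (fst (cmd_step (k, ts))), snd (cmd_step (k, ts)))"
proof (cases "k = []")
  case True
  then show ?thesis
    by (simp add: compile_def map2_act_idle)
next
  case False
  then have "state_number c k \<noteq> state_number c []"
    using state_number_inverse assms in_control_set(2) by metis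
  moreover have "state_number c k < card (control_set c)"
    by (rule state_number_less[OF assms])
  ultimately show ?thesis
    by (simp add: compile_def state_number_inverse[OF assms] split_beta)
qed

lemma funpow_step_compile:
  "k \<in> control_set c \<Longrightarrow> (step (compile c) ^^ t) (state_number c k, ts)
      = (state_number c (fst ((cmd_step ^^ t) (k, ts))), snd ((cmd_step ^^ t) (k, ts)))
    \<and> fst ((cmd_step ^^ t) (k, ts)) \<in> control_set c"
proof (induction t)
  case (Suc t)
  obtain k' ts' where eq: "(cmd_step ^^ t) (k, ts) = (k', ts')"
    by fastforce
  then have "k' \<in> control_set c"
    using Suc by simp
  then show ?case
    using Suc eq step_compile[of k' c ts'] cmd_delta_in_control_set[of k' c "map read ts'"]
    by (simp add: split_beta del: step.simps)
qed simp

lemma polytime_computable_cmd: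
  fixes P :: "nat poly"
  assumes "\<And>x. \<exists>ts. exec c (tapes x 0 0 0 0 0 []) ts (poly P (length x))
      \<and> snd (last ts) = contents_of (f x)"
  shows "polytime_computable f"
proof -
  have "\<exists>t\<le>poly P (length x). fst (run (compile c) x t) = accept (compile c) \<and>
      snd (last (snd (run (compile c) x t))) = contents_of (f x)" for x
  proof -
    obtain ts t where t: "t \<le> poly P (length x)"
        "(cmd_step ^^ t) ([c], tapes x 0 0 0 0 0 []) = ([], ts)"
      and ts: "snd (last ts) = contents_of (f x)"
      using assms[of x] by (auto simp: exec_def)
    have "initial (compile c) x = (state_number c [c], tapes x 0 0 0 0 0 [])"
      by (simp add: initial_def compile_def tapes_def numeral_eq_Suc)
    then have "run (compile c) x t = (state_number c [], ts)"
      using funpow_step_compile[OF in_control_set(1), where t = t and ts = "tapes x 0 0 0 0 0 []"]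
        t(2) by (simp add: run_def)
    then show ?thesis
      using t(1) ts by (auto simp: compile_def)
  qed
  then show ?thesis
    unfolding polytime_computable_def computes_in_time_def
    using turing_machine_compile by blast
qed

theorem polytime_computable_schema:
  "polytime_computable (\<lambda>x. pre @ concat (map g x) @ post
     @ encode (subst (ground C idx (a * (length x + 1) ^ d)) \<phi>))"
proof -
  obtain P :: "nat poly" where
    "\<And>x. \<exists>h. exec (program pre g post a d C idx \<phi>) (tapes x 0 0 0 0 0 [])
     (tapes x h (length x + 1) 0 (a * (length x + 1) ^ d) 0
       (pre @ concat (map g x) @ post
         @ encode (subst (ground C idx (a * (length x + 1) ^ d)) \<phi>)))
     (poly P (length x))"
    using exec_program[of pre g post a d C idx \<phi>] by blast
  then show ?thesis
    by (intro polytime_computable_cmd[where P = P]) (fastforce simp: tapes_def)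
qed

section \<open>Semantics of formulas and the schema\<close>

text \<open>Here the list is replaced by its length and a valuation of the atoms. All prefixes of an
  infinite trace then share the valuation and differ in \<open>n\<close> alone, and an atom can
  stand for an arbitrary predicate on positions, which is how substituted formulas are
  evaluated.\<close>

primrec sem :: "('a \<Rightarrow> nat \<Rightarrow> bool) \<Rightarrow> nat \<Rightarrow> nat \<Rightarrow> 'a ltlf \<Rightarrow> bool" where
  "sem V n i (Prop p) \<longleftrightarrow> V p i"
| "sem V n i (Neg \<phi>) \<longleftrightarrow> \<not> sem V n i \<phi>"
| "sem V n i (Conj \<phi> \<psi>) \<longleftrightarrow> sem V n i \<phi> \<and> sem V n i \<psi>"
| "sem V n i (Next \<phi>) \<longleftrightarrow> Suc i < n \<and> sem V n (Suc i) \<phi>"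
| "sem V n i (Until \<phi> \<psi>) \<longleftrightarrow>
     (\<exists>k. i \<le> k \<and> k < n \<and> sem V n k \<psi> \<and> (\<forall>j. i \<le> j \<and> j < k \<longrightarrow> sem V n j \<phi>))"

lemma holds_eq_sem:
  "i < n \<Longrightarrow> holds (map w [0..<n]) i \<phi> \<longleftrightarrow> sem (\<lambda>p i. p \<in> w i) n i \<phi>"
proof (induction \<phi> arbitrary: i)
  case (Until \<phi> \<psi>)
  have "holds (map w [0..<n]) k \<phi> = sem (\<lambda>p i. p \<in> w i) n k \<phi>"
    and "holds (map w [0..<n]) k \<psi> = sem (\<lambda>p i. p \<in> w i) n k \<psi>" if "k < n" for k
    using Until.IH that by blast+
  then show ?case
    unfolding holds.simps sem.simps by (simp, meson order.strict_trans)
qed auto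

lemma forall_satisfiable_iff_sem:
  "forall_satisfiable (atoms \<Phi>) \<Phi> \<longleftrightarrow> (\<exists>V. \<forall>n. sem V (Suc n) 0 \<Phi>)"
proof -
  have "forall_satisfiable (atoms \<Phi>) \<Phi> \<longleftrightarrow> (\<exists>w. \<forall>n\<ge>1. sem (\<lambda>p i. p \<in> w i) n 0 \<Phi>)"
    \<comment> \<open>Enlarging the alphabet to all atoms removes every restriction on the values of
      \<open>w\<close>.\<close>
    unfolding forall_satisfiable_atoms[of \<Phi> UNIV, simplified, symmetric]
    by (auto simp: forall_satisfiable_def forall_traces_def finite_traces_def holds_eq_sem)
  also have "\<dots> \<longleftrightarrow> (\<exists>w. \<forall>n. sem (\<lambda>p i. p \<in> w i) (Suc n) 0 \<Phi>)"
    by (metis One_nat_def Suc_le_D le_add1 plus_1_eq_Suc)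
  also have "\<dots> \<longleftrightarrow> (\<exists>V. \<forall>n. sem V (Suc n) 0 \<Phi>)"
  proof
    assume "\<exists>V. \<forall>n. sem V (Suc n) 0 \<Phi>"
    then obtain V where "\<forall>n. sem V (Suc n) 0 \<Phi>" ..
    then show "\<exists>w. \<forall>n. sem (\<lambda>p i. p \<in> w i) (Suc n) 0 \<Phi>"
      by (intro exI[of _ "\<lambda>i. {p. V p i}"]) simp
  qed blast
  finally show ?thesis .
qed

lemma sem_subst: "sem V n i (subst \<sigma> \<phi>) = sem (\<lambda>p i. sem V n i (\<sigma> p)) n i \<phi>"
  by (induction \<phi> arbitrary: i) simp_all

lemma sem_map: "sem V n i (map_ltlf f \<phi>) = sem (\<lambda>p. V (f p)) n i \<phi>"
  by (induction \<phi> arbitrary: i) simp_all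

section \<open>Derived connectives and temporal operators\<close>

definition Or :: "'a ltlf \<Rightarrow> 'a ltlf \<Rightarrow> 'a ltlf" where
  "Or \<phi> \<psi> = Neg (Conj (Neg \<phi>) (Neg \<psi>))"

definition Imp :: "'a ltlf \<Rightarrow> 'a ltlf \<Rightarrow> 'a ltlf" where
  "Imp \<phi> \<psi> = Neg (Conj \<phi> (Neg \<psi>))"

definition Iff :: "'a ltlf \<Rightarrow> 'a ltlf \<Rightarrow> 'a ltlf" where
  "Iff \<phi> \<psi> = Conj (Imp \<phi> \<psi>) (Imp \<psi> \<phi>)"

definition Weak_Next :: "'a ltlf \<Rightarrow> 'a ltlf" where
  "Weak_Next \<phi> = Neg (Next (Neg \<phi>))"

definition Always :: "'a ltlf \<Rightarrow> 'a ltlf" where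
  "Always \<phi> = Neg (Until (tt \<phi>) (Neg \<phi>))"

text \<open>\<open>Neg (Next (tt \<phi>))\<close> holds exactly at the last position.\<close>

definition At_Last :: "'a ltlf \<Rightarrow> 'a ltlf" where
  "At_Last \<phi> = Until (tt \<phi>) (Conj (Neg (Next (tt \<phi>))) \<phi>)"

definition Before_Last :: "'a ltlf \<Rightarrow> 'a ltlf" where
  "Before_Last \<phi> = Until \<phi> (Neg (Next (tt \<phi>)))"

lemma sem_derived [simp]:
  "sem V n i (tt \<phi>)"
  "sem V n i (Or \<phi> \<psi>) \<longleftrightarrow> sem V n i \<phi> \<or> sem V n i \<psi>"
  "sem V n i (Imp \<phi> \<psi>) \<longleftrightarrow> (sem V n i \<phi> \<longrightarrow> sem V n i \<psi>)"
  "sem V n i (Iff \<phi> \<psi>) \<longleftrightarrow> (sem V n i \<phi> \<longleftrightarrow> sem V n i \<psi>)"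
  "sem V n i (Weak_Next \<phi>) \<longleftrightarrow> (Suc i < n \<longrightarrow> sem V n (Suc i) \<phi>)"
  by (auto simp: tt_def Or_def Imp_def Iff_def Weak_Next_def)

lemma sem_Always [simp]:
  "sem V n i (Always \<phi>) \<longleftrightarrow> (\<forall>k. i \<le> k \<and> k < n \<longrightarrow> sem V n k \<phi>)"
  by (auto simp: Always_def)

lemma sem_At_Last [simp]:
  "i \<le> n \<Longrightarrow> sem V (Suc n) i (At_Last \<phi>) \<longleftrightarrow> sem V (Suc n) n \<phi>"
  by (auto simp: At_Last_def less_Suc_eq)

lemma sem_Before_Last [simp]:
  "i \<le> n \<Longrightarrow> sem V (Suc n) i (Before_Last \<phi>) \<longleftrightarrow>
     (\<forall>k. i \<le> k \<and> k < n \<longrightarrow> sem V (Suc n) k \<phi>)"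
  by (auto simp: Before_Last_def less_Suc_eq)

definition conjs :: "'a ltlf \<Rightarrow> 'a ltlf list \<Rightarrow> 'a ltlf" where
  "conjs \<beta> \<phi>s = foldr Conj \<phi>s (tt \<beta>)"

definition disjs :: "'a ltlf \<Rightarrow> 'a ltlf list \<Rightarrow> 'a ltlf" where
  "disjs \<beta> \<phi>s = Neg (conjs \<beta> (map Neg \<phi>s))"

lemma sem_conjs [simp]: "sem V n i (conjs \<beta> \<phi>s) \<longleftrightarrow> (\<forall>\<phi>\<in>set \<phi>s. sem V n i \<phi>)"
  by (induction \<phi>s) (simp_all add: conjs_def)

lemma sem_disjs [simp]: "sem V n i (disjs \<beta> \<phi>s) \<longleftrightarrow> (\<exists>\<phi>\<in>set \<phi>s. sem V n i \<phi>)"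
  by (simp add: disjs_def)

text \<open>An atom \<open>All F\<close> is itself temporal: \<open>F\<close> may refer to the end
  of the trace, and so the lifted valuation depends on the length \<open>n\<close>.\<close>

definition lift :: "('k \<Rightarrow> nat \<Rightarrow> nat \<Rightarrow> bool) \<Rightarrow> nat \<Rightarrow> nat \<Rightarrow> 'k satom \<Rightarrow> nat \<Rightarrow> bool" where
  "lift V m n a i = (case a of One k \<Rightarrow> V k 0 i
     | All F \<Rightarrow> \<forall>b<m. sem (\<lambda>(k, e). V k (b + e)) n i F)"

lemma lift_simps [simp]:
  "lift V m n (One k) i \<longleftrightarrow> V k 0 i"
  "lift V m n (All F) i \<longleftrightarrow> (\<forall>b<m. sem (\<lambda>(k, e). V k (b + e)) n i F)"
  by (simp_all add: lift_def)

lemma sem_foldr_Conj: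
  "sem V n i (foldr (\<lambda>b. Conj (f b)) bs \<phi>) \<longleftrightarrow> (\<forall>b\<in>set bs. sem V n i (f b)) \<and> sem V n i \<phi>"
  by (induction bs) auto

lemma sem_ground:
  "sem W n i (subst (ground C idx m) \<phi>) = sem (lift (\<lambda>k b. W (b * C + idx k)) m n) n i \<phi>"
proof -
  have "sem W n i (ground C idx m p) = lift (\<lambda>k b. W (b * C + idx k)) m n p i" for p i
    by (cases p) (auto simp: sem_foldr_Conj sem_map case_prod_unfold)
  then show ?thesis
    by (simp add: sem_subst)
qed

text \<open>Every position of a trace describes one step of the machine. The first positions, labelled
  \<open>Mark\<close> and \<open>Load b\<close>, write the initial tape contents while all heads move right, \<open>Jump\<close> sends
  the heads back to cell 0, and from then on \<open>Step q ss\<close> is a step in state \<open>q\<close> scanning the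
  symbols \<open>ss\<close>. The families \<open>Addr j\<close> and \<open>Carry j\<close> hold the binary position of head \<open>j\<close> and
  the carry (or borrow) bits of its update.\<close>

datatype kind =
    Mark
  | Load bool
  | Jump
  | Step nat "nat list"
  | Addr nat
  | Carry nat

instance kind :: countable
  by countable_datatype

definition letters :: "tm \<Rightarrow> kind list" where
  "letters M = [Mark, Load False, Load True, Jump] @
     concat (map (\<lambda>q. map (Step q) (List.n_lists (num_tapes M) [0..<num_symbols M]))
       [0..<num_states M])"

lemma Step_in_letters:
  "Step q ss \<in> set (letters M) \<longleftrightarrow>
     q < num_states M \<and> length ss = num_tapes M \<and> set ss \<subseteq> {..<num_symbols M}"
  by (auto simp: letters_def set_n_lists image_iff atLeast0LessThan)

lemma preamble_in_letters [simp]: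
  "Mark \<in> set (letters M)" "Load b \<in> set (letters M)" "Jump \<in> set (letters M)"
  by (cases b; simp add: letters_def)+

lemma letter_cases:
  assumes "l \<in> set (letters M)"
  obtains "l = Mark" | b where "l = Load b" | "l = Jump" | q ss where "l = Step q ss"
  using assms by (auto simp: letters_def)

definition next_state :: "tm \<Rightarrow> nat \<Rightarrow> nat list \<Rightarrow> nat" where
  "next_state M q ss = (if q = accept M \<or> q = reject M then q else fst (delta M q ss))"

text \<open>Preamble letters share the format of machine steps, so that writing the initial tapes
  becomes ordinary history; \<open>Jump\<close> writes the blank behind the input. A halting state
  rewrites what it scans and stays, which continues the trace forever.\<close>

fun acts :: "tm \<Rightarrow> kind \<Rightarrow> (nat \<times> move) list" where
  "acts M Mark = replicate (num_tapes M) (1, Right)"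
| "acts M (Load b) = (if b then 3 else 2, Right) # replicate (num_tapes M - 1) (0, Right)"
| "acts M (Step q ss) =
     (if q = accept M \<or> q = reject M then map (\<lambda>s. (s, Stay)) ss else snd (delta M q ss))"
| "acts M _ = replicate (num_tapes M) (0, Stay)"

text \<open>\<open>Mark\<close> and \<open>Load\<close> leave their successor open, because the
  preamble is fixed position by position outside the schema. In this way the schema depends on the
  input only through the number of bits.\<close>

fun follows :: "tm \<Rightarrow> kind \<Rightarrow> kind \<Rightarrow> bool" where
  "follows M (Step q ss) l \<longleftrightarrow> (\<exists>ss'. l = Step (next_state M q ss) ss')"
| "follows M Jump l \<longleftrightarrow> (\<exists>ss'. l = Step (start M) ss')"
| "follows M _ l \<longleftrightarrow> True"

text \<open>Preamble letters scan nothing and are compatible with every symbol.\<close>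

fun reads :: "nat \<Rightarrow> nat \<Rightarrow> kind \<Rightarrow> bool" where
  "reads j s (Step q ss) \<longleftrightarrow> ss ! j = s"
| "reads j s _ \<longleftrightarrow> True"

definition writes :: "tm \<Rightarrow> nat \<Rightarrow> nat \<Rightarrow> kind \<Rightarrow> bool" where
  "writes M j s l \<longleftrightarrow> fst (acts M l ! j) = s"

definition moves :: "tm \<Rightarrow> nat \<Rightarrow> move \<Rightarrow> kind \<Rightarrow> bool" where
  "moves M j d l \<longleftrightarrow> snd (acts M l ! j) = d"

definition rejecting :: "tm \<Rightarrow> kind \<Rightarrow> bool" where
  "rejecting M l \<longleftrightarrow> (\<exists>ss. l = Step (reject M) ss)"

section \<open>The formula schema constraining a trace\<close>

abbreviation base_atom :: "kind satom ltlf" where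
  "base_atom \<equiv> Prop (One Mark)"

definition lets :: "tm \<Rightarrow> (kind \<Rightarrow> bool) \<Rightarrow> kind satom ltlf" where
  "lets M P = disjs base_atom (map (\<lambda>l. Prop (One l)) (filter P (letters M)))"

lemma sem_lets [simp]:
  "sem (lift V m n') n i (lets M P) \<longleftrightarrow> (\<exists>l\<in>set (letters M). P l \<and> V l 0 i)"
  by (auto simp: lets_def)

text \<open>Equality of \<open>m\<close>-bit numbers splits into \<open>m\<close> comparisons of
  single bits, each of which fetches one bit from the end of the trace by \<open>At_Last\<close>. No
  number has to be remembered.\<close>

definition same_cell :: "nat \<Rightarrow> kind satom ltlf" where
  "same_cell j = Prop (All (Iff (Prop (Addr j, 0)) (At_Last (Prop (Addr j, 0)))))"

definition at_zero :: "nat \<Rightarrow> kind satom ltlf" where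
  "at_zero j = Prop (All (Neg (Prop (Addr j, 0))))"

text \<open>The exclusive or of bit and carry gives the new bit for addition and for subtraction
  alike. The premise exempts the last position of a prefix, which has no successor.\<close>

definition sum_bit :: "nat \<Rightarrow> (kind \<times> nat) ltlf" where
  "sum_bit j = Imp (Next (tt (Prop (Addr j, 0))))
     (Iff (Next (Prop (Addr j, 0))) (Neg (Iff (Prop (Addr j, 0)) (Prop (Carry j, 0)))))"

definition increment :: "nat \<Rightarrow> kind satom ltlf" where
  "increment j = Prop (All (Conj (sum_bit j)
     (Iff (Prop (Carry j, 1)) (Conj (Prop (Carry j, 0)) (Prop (Addr j, 0))))))"

definition decrement :: "nat \<Rightarrow> kind satom ltlf" where
  "decrement j = Prop (All (Conj (sum_bit j)
     (Iff (Prop (Carry j, 1)) (Conj (Prop (Carry j, 0)) (Neg (Prop (Addr j, 0)))))))"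

text \<open>Staying is an increment without incoming carry. The last constraint determines the carry
  into bit 0: it is set for a right move, and for a left move unless the head is at cell 0, which
  reproduces the truncated subtraction of \<open>move_head\<close>.\<close>

definition head_constraints :: "tm \<Rightarrow> nat \<Rightarrow> kind satom ltlf list" where
  "head_constraints M j =
     [at_zero j,
      Always (Imp (lets M (\<lambda>l. l = Jump)) (Weak_Next (at_zero j))),
      Always (Imp (lets M (\<lambda>l. l \<noteq> Jump \<and> \<not> moves M j Left l)) (increment j)),
      Always (Imp (lets M (\<lambda>l. l \<noteq> Jump \<and> moves M j Left l)) (decrement j)),
      Always (Iff (Prop (One (Carry j)))
        (Or (lets M (moves M j Right)) (Conj (lets M (moves M j Left)) (Neg (at_zero j)))))]"

text \<open>The first constraint treats a cell visited for the first time, which must be blank. Each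
  other one looks at an earlier position with the same address and no visit in between; the strict
  \<open>Next\<close> excludes the last position itself, whose own write comes after its read. One
  copy for each symbol links the written symbol to the one read.\<close>

definition read_constraints :: "tm \<Rightarrow> nat \<Rightarrow> kind satom ltlf list" where
  "read_constraints M j =
     Imp (Before_Last (Neg (same_cell j))) (At_Last (lets M (reads j 0))) #
     map (\<lambda>s. Always (Imp
         (Conj (lets M (writes M j s))
           (Conj (same_cell j) (Next (Before_Last (Neg (same_cell j))))))
         (At_Last (lets M (reads j s)))))
       [0..<num_symbols M]"

definition letter_constraints :: "tm \<Rightarrow> kind satom ltlf list" where
  "letter_constraints M =
     Always (lets M (\<lambda>l. \<not> rejecting M l)) #
     map (\<lambda>l. Always (Imp (Prop (One l)) (Neg (lets M (\<lambda>l'. l' \<noteq> l))))) (letters M) @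
     map (\<lambda>l. Always (Imp (Prop (One l)) (Weak_Next (lets M (follows M l))))) (letters M)"

definition schema :: "tm \<Rightarrow> kind satom ltlf" where
  "schema M = conjs base_atom (letter_constraints M @
     concat (map (\<lambda>j. head_constraints M j @ read_constraints M j) [0..<num_tapes M]))"

text \<open>This predicate and the two that follow express the constraints on the infinite trace.
  The prefix length disappears from the first two; in \<open>read_ok\<close> it survives as the
  position \<open>n\<close> whose scanned symbol is checked.\<close>

definition letter_ok :: "tm \<Rightarrow> (kind \<Rightarrow> nat \<Rightarrow> nat \<Rightarrow> bool) \<Rightarrow> bool" where
  "letter_ok M V \<longleftrightarrow>
     (\<forall>i. (\<exists>l\<in>set (letters M). \<not> rejecting M l \<and> V l 0 i) \<and>
       (\<forall>l\<in>set (letters M). V l 0 i \<longrightarrow>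
         (\<forall>l'\<in>set (letters M). l' \<noteq> l \<longrightarrow> \<not> V l' 0 i) \<and>
         (\<exists>l'\<in>set (letters M). follows M l l' \<and> V l' 0 (Suc i))))"

definition head_ok :: "tm \<Rightarrow> nat \<Rightarrow> (kind \<Rightarrow> nat \<Rightarrow> nat \<Rightarrow> bool) \<Rightarrow> nat \<Rightarrow> bool" where
  "head_ok M m V j \<longleftrightarrow>
     (\<forall>b<m. \<not> V (Addr j) b 0) \<and>
     (\<forall>i. V Jump 0 i \<longrightarrow> (\<forall>b<m. \<not> V (Addr j) b (Suc i))) \<and>
     (\<forall>i. (\<exists>l\<in>set (letters M). l \<noteq> Jump \<and> \<not> moves M j Left l \<and> V l 0 i) \<longrightarrow>
       (\<forall>b<m. (V (Addr j) b (Suc i) \<longleftrightarrow> (V (Addr j) b i \<noteq> V (Carry j) b i)) \<and>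
         (V (Carry j) (Suc b) i \<longleftrightarrow> V (Carry j) b i \<and> V (Addr j) b i))) \<and>
     (\<forall>i. (\<exists>l\<in>set (letters M). l \<noteq> Jump \<and> moves M j Left l \<and> V l 0 i) \<longrightarrow>
       (\<forall>b<m. (V (Addr j) b (Suc i) \<longleftrightarrow> (V (Addr j) b i \<noteq> V (Carry j) b i)) \<and>
         (V (Carry j) (Suc b) i \<longleftrightarrow> V (Carry j) b i \<and> \<not> V (Addr j) b i))) \<and>
     (\<forall>i. V (Carry j) 0 i \<longleftrightarrow>
       (\<exists>l\<in>set (letters M). moves M j Right l \<and> V l 0 i) \<or>
       (\<exists>l\<in>set (letters M). moves M j Left l \<and> V l 0 i) \<and> \<not> (\<forall>b<m. \<not> V (Addr j) b i))"

definition read_ok :: "tm \<Rightarrow> nat \<Rightarrow> (kind \<Rightarrow> nat \<Rightarrow> nat \<Rightarrow> bool) \<Rightarrow> nat \<Rightarrow> bool" where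
  "read_ok M m V j \<longleftrightarrow>
     (let same = (\<lambda>i n. \<forall>b<m. V (Addr j) b i = V (Addr j) b n) in
      \<forall>n. ((\<forall>k<n. \<not> same k n) \<longrightarrow> (\<exists>l\<in>set (letters M). reads j 0 l \<and> V l 0 n)) \<and>
        (\<forall>i<n. \<forall>s<num_symbols M.
          (\<exists>l\<in>set (letters M). writes M j s l \<and> V l 0 i) \<and> same i n \<and>
          (\<forall>k. i < k \<and> k < n \<longrightarrow> \<not> same k n) \<longrightarrow>
          (\<exists>l\<in>set (letters M). reads j s l \<and> V l 0 n)))"

text \<open>A local condition imposed at \<open>k\<close> by all prefixes reaching \<open>k\<close>
  is a condition on the infinite trace: the prefix ending at \<open>k\<close> yields it or, if the
  successor is mentioned, the one ending at \<open>Suc k\<close>.\<close>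

lemma all_prefixes_iff: "(\<forall>n k::nat. k \<le> n \<longrightarrow> P k) \<longleftrightarrow> (\<forall>k. P k)"
  by (meson order_refl)

lemma all_prefixes_Suc_iff: "(\<forall>n k. k \<le> n \<longrightarrow> P k \<longrightarrow> Suc k \<le> n \<longrightarrow> Q k) \<longleftrightarrow> (\<forall>k. P k \<longrightarrow> Q k)"
  by (meson Suc_leD order_refl)

lemma sem_letter_constraints:
  "(\<forall>n. \<forall>\<phi>\<in>set (letter_constraints M). sem (lift V m (Suc n)) (Suc n) 0 \<phi>) \<longleftrightarrow> letter_ok M V"
  (is "?L \<longleftrightarrow> _")
proof -
  have "?L \<longleftrightarrow> (\<forall>n k. k \<le> n \<longrightarrow> (\<exists>l\<in>set (letters M). \<not> rejecting M l \<and> V l 0 k)) \<and>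
     (\<forall>l\<in>set (letters M). \<forall>n k. k \<le> n \<longrightarrow> V l 0 k \<longrightarrow>
       \<not> (\<exists>l'\<in>set (letters M). l' \<noteq> l \<and> V l' 0 k)) \<and>
     (\<forall>l\<in>set (letters M). \<forall>n k. k \<le> n \<longrightarrow> V l 0 k \<longrightarrow> Suc k \<le> n \<longrightarrow>
       (\<exists>l'\<in>set (letters M). follows M l l' \<and> V l' 0 (Suc k)))"
    by (simp add: letter_constraints_def ball_Un less_Suc_eq_le) blast
  then show ?thesis
    unfolding all_prefixes_iff all_prefixes_Suc_iff letter_ok_def by blast
qed

lemma all_prefixes_mixed_iff:
  "(\<forall>n k. k \<le> n \<longrightarrow> P k \<longrightarrow> (\<forall>b<m. (Suc k \<le> n \<longrightarrow> Q k b) \<and> R k b)) \<longleftrightarrow>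
     (\<forall>k. P k \<longrightarrow> (\<forall>b<m. Q k b \<and> R k b))"
  by (meson Suc_leD order_refl)

lemma sem_head_constraints:
  "(\<forall>n. \<forall>\<phi>\<in>set (head_constraints M j). sem (lift V m (Suc n)) (Suc n) 0 \<phi>) \<longleftrightarrow> head_ok M m V j"
proof -
  have zero: "sem (lift V m n) n i (at_zero j) \<longleftrightarrow> (\<forall>b<m. \<not> V (Addr j) b i)" for n i
    by (simp add: at_zero_def)
  have sum_bit: "sem (\<lambda>(k, e). V k (b + e)) (Suc n) i (sum_bit j) \<longleftrightarrow>
      (Suc i \<le> n \<longrightarrow> (V (Addr j) b (Suc i) \<longleftrightarrow> (V (Addr j) b i \<noteq> V (Carry j) b i)))" for b n i
    by (auto simp: sum_bit_def)
  have inc: "sem (lift V m (Suc n)) (Suc n) i (increment j) \<longleftrightarrow>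
      (\<forall>b<m. (Suc i \<le> n \<longrightarrow> (V (Addr j) b (Suc i) \<longleftrightarrow> (V (Addr j) b i \<noteq> V (Carry j) b i))) \<and>
         (V (Carry j) (Suc b) i \<longleftrightarrow> V (Carry j) b i \<and> V (Addr j) b i))" for n i
    by (simp add: increment_def sum_bit)
  have dec: "sem (lift V m (Suc n)) (Suc n) i (decrement j) \<longleftrightarrow>
      (\<forall>b<m. (Suc i \<le> n \<longrightarrow> (V (Addr j) b (Suc i) \<longleftrightarrow> (V (Addr j) b i \<noteq> V (Carry j) b i))) \<and>
         (V (Carry j) (Suc b) i \<longleftrightarrow> V (Carry j) b i \<and> \<not> V (Addr j) b i))" for n i
    by (simp add: decrement_def sum_bit)
  have jump: "(\<exists>l\<in>set (letters M). l = Jump \<and> V l 0 k) \<longleftrightarrow> V Jump 0 k" for k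
    by auto
  show ?thesis
    by (simp only: head_constraints_def list.set ball_simps sem_Always sem_derived sem_lets zero
        inc dec all_conj_distrib less_Suc_eq_le le0 simp_thms sem.simps lift_simps jump conj_assoc
        head_ok_def all_prefixes_mixed_iff all_prefixes_Suc_iff all_prefixes_iff)
qed

lemma sem_read_constraints:
  "(\<forall>n. \<forall>\<phi>\<in>set (read_constraints M j). sem (lift V m (Suc n)) (Suc n) 0 \<phi>) \<longleftrightarrow> read_ok M m V j"
proof -
  have same: "sem (lift V m (Suc n)) (Suc n) i (same_cell j) \<longleftrightarrow>
      (\<forall>b<m. V (Addr j) b i = V (Addr j) b n)" if "i \<le> n" for i n
    using that by (simp add: same_cell_def)
  let ?W = "\<lambda>s n i. (\<exists>l\<in>set (letters M). writes M j s l \<and> V l 0 i)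
      \<and> (\<forall>b<m. V (Addr j) b i = V (Addr j) b n)
      \<and> (\<forall>k. Suc i \<le> k \<and> k < n \<longrightarrow> \<not> (\<forall>b<m. V (Addr j) b k = V (Addr j) b n))"
  have pair: "sem (lift V m (Suc n)) (Suc n) i (Imp
         (Conj (lets M (writes M j s))
           (Conj (same_cell j) (Next (Before_Last (Neg (same_cell j))))))
         (At_Last (lets M (reads j s))))
      \<longleftrightarrow> (i < n \<and> ?W s n i \<longrightarrow> (\<exists>l\<in>set (letters M). reads j s l \<and> V l 0 n))"
    if "i \<le> n" for i n s
    using that same by (cases "i = n") (auto simp: same)
  have fresh: "sem (lift V m (Suc n)) (Suc n) 0
        (Imp (Before_Last (Neg (same_cell j))) (At_Last (lets M (reads j 0))))
      \<longleftrightarrow> ((\<forall>k<n. \<not> (\<forall>b<m. V (Addr j) b k = V (Addr j) b n)) \<longrightarrow>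
        (\<exists>l\<in>set (letters M). reads j 0 l \<and> V l 0 n))" for n
    by (simp add: same)
  have "(\<forall>\<phi>\<in>set (read_constraints M j). sem (lift V m (Suc n)) (Suc n) 0 \<phi>) \<longleftrightarrow>
      ((\<forall>k<n. \<not> (\<forall>b<m. V (Addr j) b k = V (Addr j) b n)) \<longrightarrow>
        (\<exists>l\<in>set (letters M). reads j 0 l \<and> V l 0 n)) \<and>
      (\<forall>s<num_symbols M. \<forall>i\<le>n. i < n \<and> ?W s n i \<longrightarrow> (\<exists>l\<in>set (letters M). reads j s l \<and> V l 0 n))" for n
    unfolding read_constraints_def list.set set_map ball_simps sem_Always less_Suc_eq_le
    by (simp only: set_upt atLeast0LessThan lessThan_iff Ball_def pair fresh le0 simp_thms
        cong: imp_cong)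
  moreover have "(\<forall>s<S. \<forall>i\<le>n. i < n \<and> P s i \<longrightarrow> R s) \<longleftrightarrow> (\<forall>i<n. \<forall>s<S. P s i \<longrightarrow> R s)"
    for S n :: nat and P R
    by (meson less_imp_le_nat)
  ultimately show ?thesis
    unfolding read_ok_def Let_def Suc_le_eq by (simp only:)
qed

lemma sem_schema:
  "(\<forall>n. sem (lift V m (Suc n)) (Suc n) 0 (schema M)) \<longleftrightarrow>
     letter_ok M V \<and> (\<forall>j<num_tapes M. head_ok M m V j \<and> read_ok M m V j)"
  unfolding sem_letter_constraints[of M V m, symmetric] sem_head_constraints[symmetric]
    sem_read_constraints[symmetric] schema_def
  by (auto simp: ball_Un)

section \<open>Traces\<close>

lemma bit_beyond: "h < 2 ^ m \<Longrightarrow> m \<le> b \<Longrightarrow> \<not> bit h b" for h :: nat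
  by (metis bit_take_bit_iff leD take_bit_nat_eq_self)

lemma bits_eqI:
  fixes h h' :: nat
  assumes "h < 2 ^ m" "h' < 2 ^ m" "\<And>b. b < m \<Longrightarrow> bit h b \<longleftrightarrow> bit h' b"
  shows "h = h'"
proof (rule bit_eqI)
  fix b
  show "bit h b \<longleftrightarrow> bit h' b"
    using assms bit_beyond[of h m b] bit_beyond[of h' m b] by (cases "b < m") simp_all
qed

lemma ex_nat_bits: "\<exists>h::nat. h < 2 ^ m \<and> (\<forall>b<m. bit h b \<longleftrightarrow> f b)"
proof -
  let ?h = "horner_sum of_bool 2 (map f [0..<m]) :: nat"
  have "bit (take_bit m ?h) b \<longleftrightarrow> f b" if "b < m" for b
    using that by (simp add: bit_take_bit_iff bit_horner_sum_bit_iff)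
  moreover have "take_bit m ?h < 2 ^ m"
    by simp
  ultimately show ?thesis
    by blast
qed

text \<open>After the \<open>b\<close> lowest bits are dropped, old and new position differ exactly
  by the carry or borrow into bit \<open>b\<close>; this is the invariant of both inductions, and
  comparing parities gives the claim. A carry passes through ones and a borrow through zeros, which
  \<open>bit h b \<longleftrightarrow> d \<noteq> Left\<close> expresses uniformly.\<close>

lemma bit_move_head:
  assumes c0: "c 0 \<longleftrightarrow> move_head d h \<noteq> h"
    and c_Suc: "\<And>b. b < m \<Longrightarrow> c (Suc b) \<longleftrightarrow> c b \<and> (bit h b \<longleftrightarrow> d \<noteq> Left)"
    and "b < m"
  shows "bit (move_head d h) b \<longleftrightarrow> (bit h b \<noteq> c b)"
proof (cases "d = Left")
  case True
  let ?g = "move_head d h"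
  have "h div 2 ^ b = ?g div 2 ^ b + of_bool (c b)" if "b \<le> m" for b
    using that
  proof (induction b)
    case 0
    then show ?case
      using c0 True by auto
  next
    case (Suc b)
    have "c (Suc b) \<longleftrightarrow> c b \<and> even (h div 2 ^ b)"
      using c_Suc[of b] Suc.prems True by (simp add: bit_iff_odd)
    moreover have "h div 2 ^ b = ?g div 2 ^ b + of_bool (c b)"
      using Suc by simp
    moreover have "y div 2 = z div 2 + of_bool (e \<and> even y)" if "y = z + of_bool e"
      for y z :: nat and e
      using that by (cases e) (auto elim!: evenE oddE)
    ultimately show ?case
      by (simp only: power_Suc2 div_mult2_eq)
  qed
  then show ?thesis
    using \<open>b < m\<close> by (auto simp: bit_iff_odd)
next
  case False
  let ?g = "move_head d h"
  have "?g div 2 ^ b = h div 2 ^ b + of_bool (c b)" if "b \<le> m" for b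
    using that
  proof (induction b)
    case 0
    then show ?case
      using c0 False by (cases d) auto
  next
    case (Suc b)
    have "c (Suc b) \<longleftrightarrow> c b \<and> odd (h div 2 ^ b)"
      using c_Suc[of b] Suc.prems False by (simp add: bit_iff_odd)
    moreover have "?g div 2 ^ b = h div 2 ^ b + of_bool (c b)"
      using Suc by simp
    moreover have "y div 2 = z div 2 + of_bool (e \<and> odd z)" if "y = z + of_bool e"
      for y z :: nat and e
      using that by (cases e) (auto elim!: evenE oddE)
    ultimately show ?case
      by (simp only: power_Suc2 div_mult2_eq)
  qed
  then show ?thesis
    using \<open>b < m\<close> by (auto simp: bit_iff_odd)
qed

primrec carry :: "move \<Rightarrow> nat \<Rightarrow> nat \<Rightarrow> bool" where
  "carry d h 0 \<longleftrightarrow> move_head d h \<noteq> h"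
| "carry d h (Suc b) \<longleftrightarrow> carry d h b \<and> (bit h b \<longleftrightarrow> d \<noteq> Left)"

text \<open>The tape that the history of the trace determines. It starts entirely blank, without
  even the marker, because the preamble writes the initial contents.\<close>

primrec written :: "tm \<Rightarrow> (nat \<Rightarrow> kind) \<Rightarrow> (nat \<Rightarrow> nat \<Rightarrow> nat) \<Rightarrow> nat \<Rightarrow> nat \<Rightarrow> nat \<Rightarrow> nat" where
  "written M l h j 0 = (\<lambda>_. 0)"
| "written M l h j (Suc n) = (written M l h j n)(h j n := fst (acts M (l n) ! j))"

text \<open>A cell shows the symbol of its last visit or, if never visited, the blank: the same
  distinction as between the two kinds of read constraints.\<close>

lemma written_cases:
  "(\<forall>k<n. h j k \<noteq> a) \<and> written M l h j n a = 0 \<or>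
   (\<exists>i<n. h j i = a \<and> (\<forall>k. i < k \<and> k < n \<longrightarrow> h j k \<noteq> a) \<and>
      written M l h j n a = fst (acts M (l i) ! j))"
proof (induction n)
  case (Suc n)
  show ?case
  proof (cases "h j n = a")
    case True
    then show ?thesis
      by (intro disjI2 exI[of _ n]) auto
  next
    case False
    then show ?thesis
      using Suc less_Suc_eq by auto
  qed
qed simp

definition letter_trace :: "tm \<Rightarrow> (nat \<Rightarrow> kind) \<Rightarrow> bool" where
  "letter_trace M l \<longleftrightarrow>
     (\<forall>i. l i \<in> set (letters M) \<and> \<not> rejecting M (l i) \<and> follows M (l i) (l (Suc i)))"

text \<open>Nothing is claimed about a head that would leave the addressable cells: its binary counter
  may overflow. The space bound of the machine excludes this case.\<close>

definition head_trace :: "tm \<Rightarrow> nat \<Rightarrow> (nat \<Rightarrow> kind) \<Rightarrow> (nat \<Rightarrow> nat \<Rightarrow> nat) \<Rightarrow> nat \<Rightarrow> bool" where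
  "head_trace M m l h j \<longleftrightarrow> h j 0 = 0 \<and>
     (\<forall>i. h j i < 2 ^ m \<and>
       (l i = Jump \<longrightarrow> h j (Suc i) = 0) \<and>
       (l i \<noteq> Jump \<and> move_head (snd (acts M (l i) ! j)) (h j i) < 2 ^ m \<longrightarrow>
         h j (Suc i) = move_head (snd (acts M (l i) ! j)) (h j i)))"

definition read_trace :: "tm \<Rightarrow> (nat \<Rightarrow> kind) \<Rightarrow> (nat \<Rightarrow> nat \<Rightarrow> nat) \<Rightarrow> nat \<Rightarrow> bool" where
  "read_trace M l h j \<longleftrightarrow> (\<forall>n. reads j (written M l h j n (h j n)) (l n))"

lemma delta_valid:
  assumes "turing_machine M" "q < num_states M" "length ss = num_tapes M"
    "set ss \<subseteq> {..<num_symbols M}"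
  shows "fst (delta M q ss) < num_states M" "length (snd (delta M q ss)) = num_tapes M"
    "fst ` set (snd (delta M q ss)) \<subseteq> {..<num_symbols M}"
proof -
  have "\<forall>q < num_states M. \<forall>ss. length ss = num_tapes M \<and> set ss \<subseteq> {..<num_symbols M} \<longrightarrow>
      (case delta M q ss of (q', as) \<Rightarrow> q' < num_states M \<and> length as = num_tapes M \<and>
        fst ` set as \<subseteq> {..<num_symbols M})"
    using assms(1) unfolding turing_machine_def by (elim conjE)
  from this[rule_format, OF assms(2) conjI, OF assms(3,4)]
  show "fst (delta M q ss) < num_states M" "length (snd (delta M q ss)) = num_tapes M"
    "fst ` set (snd (delta M q ss)) \<subseteq> {..<num_symbols M}"
    by (simp_all add: split_beta)
qed

lemma acts_letter:
  assumes "turing_machine M" "l \<in> set (letters M)"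
  shows "length (acts M l) = num_tapes M" "j < num_tapes M \<Longrightarrow> fst (acts M l ! j) < num_symbols M"
proof -
  have K: "num_tapes M \<ge> 1" "num_symbols M \<ge> 4"
    using assms(1) by (simp_all add: turing_machine_def)
  have "length (acts M l) = num_tapes M \<and> fst ` set (acts M l) \<subseteq> {..<num_symbols M}"
  proof (cases rule: letter_cases[OF assms(2)])
    case (4 q ss)
    then have q: "q < num_states M" "length ss = num_tapes M" "set ss \<subseteq> {..<num_symbols M}"
      using assms(2) by (simp_all add: Step_in_letters)
    show ?thesis
      using q delta_valid[OF assms(1) q] by (auto simp: 4)
  qed (use K in auto)
  then show "length (acts M l) = num_tapes M"
    and "j < num_tapes M \<Longrightarrow> fst (acts M l ! j) < num_symbols M"
    by (simp_all add: subset_eq)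
qed

lemma trace_of_valuation:
  assumes tm: "turing_machine M" and letter: "letter_ok M V"
    and head: "\<And>j. j < num_tapes M \<Longrightarrow> head_ok M m V j"
    and read: "\<And>j. j < num_tapes M \<Longrightarrow> read_ok M m V j"
  obtains l h where "letter_trace M l" "\<And>l' i. l' \<in> set (letters M) \<Longrightarrow> V l' 0 i \<longleftrightarrow> l' = l i"
    "\<And>j. j < num_tapes M \<Longrightarrow> head_trace M m l h j" "\<And>j. j < num_tapes M \<Longrightarrow> read_trace M l h j"
proof -
  have "\<forall>i. \<exists>l. l \<in> set (letters M) \<and> \<not> rejecting M l \<and> V l 0 i"
    using letter unfolding letter_ok_def by blast
  from choice[OF this] obtain l where
    "\<forall>i. l i \<in> set (letters M) \<and> \<not> rejecting M (l i) \<and> V (l i) 0 i" ..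
  then have l: "l i \<in> set (letters M) \<and> \<not> rejecting M (l i) \<and> V (l i) 0 i" for i
    by (rule spec)
  have unique: "V l' 0 i \<longleftrightarrow> l' = l i" if "l' \<in> set (letters M)" for l' i
    using letter l[of i] that unfolding letter_ok_def by blast
  have letters: "letter_trace M l"
    unfolding letter_trace_def
  proof
    fix i
    obtain l' where "l' \<in> set (letters M)" "follows M (l i) l'" "V l' 0 (Suc i)"
      using letter l[of i] unfolding letter_ok_def by blast
    then show "l i \<in> set (letters M) \<and> \<not> rejecting M (l i) \<and> follows M (l i) (l (Suc i))"
      using l unique by metis
  qed
  define h where "h j i = (SOME k::nat. k < 2 ^ m \<and> (\<forall>b<m. bit k b \<longleftrightarrow> V (Addr j) b i))" for j i
  have "h j i < 2 ^ m \<and> (\<forall>b<m. bit (h j i) b \<longleftrightarrow> V (Addr j) b i)" for j i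
    unfolding h_def by (rule someI_ex[OF ex_nat_bits])
  then have h_less: "h j i < 2 ^ m" and bit_h: "b < m \<Longrightarrow> bit (h j i) b \<longleftrightarrow> V (Addr j) b i"
    for j i b
    by blast+
  have ex_letter: "(\<exists>l'\<in>set (letters M). P l' \<and> V l' 0 i) \<longleftrightarrow> P (l i)" for P i
    using l unique by metis
  have ex_letter2: "(\<exists>l'\<in>set (letters M). P l' \<and> Q l' \<and> V l' 0 i) \<longleftrightarrow> P (l i) \<and> Q (l i)"
    for P Q i
    using l unique by metis
  have zero: "(\<forall>b<m. \<not> V (Addr j) b i) \<longleftrightarrow> h j i = 0" for i j
    using bits_eqI[of "h j i" m 0] h_less[of j i] bit_h[of _ j i] by auto
  have heads: "head_trace M m l h j" if "j < num_tapes M" for j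
  proof -
    let ?d = "\<lambda>i. snd (acts M (l i) ! j)"
    note ok = head[OF that, unfolded head_ok_def zero ex_letter ex_letter2 moves_def]
    note start = ok[THEN conjunct1]
      and jump = ok[THEN conjunct2, THEN conjunct1, rule_format]
      and inc = ok[THEN conjunct2, THEN conjunct2, THEN conjunct1, rule_format]
      and dec = ok[THEN conjunct2, THEN conjunct2, THEN conjunct2, THEN conjunct1, rule_format]
      and carry = ok[THEN conjunct2, THEN conjunct2, THEN conjunct2, THEN conjunct2, rule_format]
    \<comment> \<open>By \<open>less\<close> the new position also fits into \<open>m\<close> bits,
      so agreement on these bits is equality.\<close>
    have "h j (Suc i) = move_head (?d i) (h j i)"
      if "l i \<noteq> Jump" and less: "move_head (?d i) (h j i) < 2 ^ m" for i
    proof (rule bits_eqI[OF h_less less])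
      fix b assume b: "b < m"
      have step: "(V (Addr j) b (Suc i) \<longleftrightarrow> (V (Addr j) b i \<noteq> V (Carry j) b i)) \<and>
          (V (Carry j) (Suc b) i \<longleftrightarrow> V (Carry j) b i \<and> (V (Addr j) b i \<longleftrightarrow> ?d i \<noteq> Left))"
        if "b < m" for b
        using inc[of i b] dec[of i b] \<open>l i \<noteq> Jump\<close> that by (cases "?d i = Left") simp_all
      have "bit (move_head (?d i) (h j i)) b \<longleftrightarrow> (bit (h j i) b \<noteq> V (Carry j) b i)"
      proof (rule bit_move_head[where m = m])
        show "V (Carry j) 0 i \<longleftrightarrow> move_head (?d i) (h j i) \<noteq> h j i"
          unfolding carry by (cases "?d i") auto
      qed (use step bit_h b in auto)
      then show "bit (h j (Suc i)) b \<longleftrightarrow> bit (move_head (?d i) (h j i)) b"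
        using step bit_h b by auto
    qed
    moreover have "h j (Suc i) = 0" if "l i = Jump" for i
      using jump l[of i] that by simp
    ultimately show ?thesis
      unfolding head_trace_def using start h_less by blast
  qed
  have reads: "read_trace M l h j" if j: "j < num_tapes M" for j
    unfolding read_trace_def
  proof
    fix n
    have same: "(\<forall>b<m. V (Addr j) b i = V (Addr j) b n) \<longleftrightarrow> h j i = h j n" for i
      using bits_eqI[OF h_less h_less] bit_h by metis
    note ok = read[OF j, unfolded read_ok_def Let_def, rule_format, of n, unfolded same ex_letter]
    from written_cases[of n h j "h j n" M l] show "reads j (written M l h j n (h j n)) (l n)"
    proof (elim disjE conjE exE)
      fix i assume i: "i < n" "h j i = h j n" "\<forall>k. i < k \<and> k < n \<longrightarrow> h j k \<noteq> h j n"
        and eq: "written M l h j n (h j n) = fst (acts M (l i) ! j)"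
      have "writes M j (fst (acts M (l i) ! j)) (l i)"
        by (simp add: writes_def)
      moreover have "fst (acts M (l i) ! j) < num_symbols M"
        using acts_letter(2)[OF tm] l j by blast
      ultimately show ?thesis
        unfolding eq using ok i by blast
    qed (use ok in auto)
  qed
  show ?thesis
    using that letters unique heads reads by blast
qed

section \<open>Valuations obtained from traces\<close>

lemma letter_ok_of_trace:
  assumes letter: "letter_trace M l"
    and V_letter: "\<And>l' i. l' \<in> set (letters M) \<Longrightarrow> V l' 0 i \<longleftrightarrow> l' = l i"
  shows "letter_ok M V"
  unfolding letter_ok_def
proof (intro allI conjI ballI impI)
  fix i
  have l: "l i \<in> set (letters M)" "\<not> rejecting M (l i)" "follows M (l i) (l (Suc i))"
      "l (Suc i) \<in> set (letters M)" for i
    using letter by (simp_all add: letter_trace_def)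
  show "\<exists>l'\<in>set (letters M). \<not> rejecting M l' \<and> V l' 0 i"
    using l V_letter by blast
  fix l' assume l': "l' \<in> set (letters M)" "V l' 0 i"
  then have "l' = l i"
    using V_letter by blast
  then show "\<exists>l''\<in>set (letters M). follows M l' l'' \<and> V l'' 0 (Suc i)"
    using l V_letter by blast
  show "\<not> V l'' 0 i" if "l'' \<in> set (letters M)" "l'' \<noteq> l'" for l''
    using V_letter[OF that(1)] that(2) \<open>l' = l i\<close> by blast
qed

lemma head_ok_of_trace:
  assumes letter: "letter_trace M l"
    and V_letter: "\<And>l' i. l' \<in> set (letters M) \<Longrightarrow> V l' 0 i \<longleftrightarrow> l' = l i"
    and V_Addr: "\<And>b i. V (Addr j) b i \<longleftrightarrow> bit (h j i) b"
    and V_Carry: "\<And>b i. V (Carry j) b i \<longleftrightarrow> carry (snd (acts M (l i) ! j)) (h j i) b"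
    and h: "h j 0 = 0" "\<And>i. h j i < 2 ^ m" "\<And>i. l i = Jump \<Longrightarrow> h j (Suc i) = 0"
      "\<And>i. l i \<noteq> Jump \<Longrightarrow> h j (Suc i) = move_head (snd (acts M (l i) ! j)) (h j i)"
  shows "head_ok M m V j"
proof -
  have l: "l i \<in> set (letters M)" for i
    using letter by (simp add: letter_trace_def)
  have ex_letter: "(\<exists>l'\<in>set (letters M). P l' \<and> V l' 0 i) \<longleftrightarrow> P (l i)" for P i
    using l V_letter by metis
  have ex_letter2: "(\<exists>l'\<in>set (letters M). P l' \<and> Q l' \<and> V l' 0 i) \<longleftrightarrow> P (l i) \<and> Q (l i)"
    for P Q i
    using l V_letter by metis
  have zero: "(\<forall>b<m. \<not> bit (h j i) b) \<longleftrightarrow> h j i = 0" for i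
    using bits_eqI[of "h j i" m 0] h(2)[of i] by auto
  have "bit (h j (Suc i)) b \<longleftrightarrow> (bit (h j i) b \<noteq> carry (snd (acts M (l i) ! j)) (h j i) b)"
    if "l i \<noteq> Jump" for i b
    unfolding h(4)[OF that] by (rule bit_move_head[where m = "Suc b"]) simp_all
  moreover have "(move_head d k \<noteq> k) \<longleftrightarrow> (d = Right \<or> d = Left \<and> k \<noteq> 0)" for d k
    by (cases d) auto
  ultimately show ?thesis
    unfolding head_ok_def ex_letter ex_letter2 moves_def V_Addr V_Carry zero V_letter[OF preamble_in_letters(3)]
    using h(1,3) by auto
qed

lemma read_ok_of_trace:
  assumes letter: "letter_trace M l"
    and V_letter: "\<And>l' i. l' \<in> set (letters M) \<Longrightarrow> V l' 0 i \<longleftrightarrow> l' = l i"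
    and V_Addr: "\<And>b i. V (Addr j) b i \<longleftrightarrow> bit (h j i) b"
    and h: "\<And>i. h j i < 2 ^ m"
    and read: "read_trace M l h j"
  shows "read_ok M m V j"
proof -
  have l: "l i \<in> set (letters M)" for i
    using letter by (simp add: letter_trace_def)
  have ex_letter: "(\<exists>l'\<in>set (letters M). P l' \<and> V l' 0 i) \<longleftrightarrow> P (l i)" for P i
    using l V_letter by metis
  have same: "(\<forall>b<m. bit (h j i) b = bit (h j n) b) \<longleftrightarrow> h j i = h j n" for i n
    using bits_eqI[OF h h] by metis
  have read: "reads j (written M l h j n (h j n)) (l n)" for n
    using read by (simp add: read_trace_def)
  have "reads j 0 (l n)" if "\<forall>k<n. h j k \<noteq> h j n" for n
    using read[of n] written_cases[of n h j "h j n" M l] that by auto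
  moreover have "reads j (fst (acts M (l i) ! j)) (l n)"
    if "i < n" "h j i = h j n" "\<forall>k. i < k \<and> k < n \<longrightarrow> h j k \<noteq> h j n" for i n
  proof -
    have "\<exists>i'<n. h j i' = h j n \<and> (\<forall>k. i' < k \<and> k < n \<longrightarrow> h j k \<noteq> h j n) \<and>
        written M l h j n (h j n) = fst (acts M (l i') ! j)"
      using written_cases[of n h j "h j n" M l] that by blast
    then obtain i' where "i' < n" "h j i' = h j n" "\<forall>k. i' < k \<and> k < n \<longrightarrow> h j k \<noteq> h j n"
        and eq: "written M l h j n (h j n) = fst (acts M (l i') ! j)"
      by blast
    \<comment> \<open>Two last visits before \<open>n\<close> coincide, since otherwise the later
      one would lie between the earlier one and \<open>n\<close>.\<close>
    then have "i' = i"
      using that by (metis linorder_neqE_nat)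
    then show ?thesis
      using read[of n] eq by simp
  qed
  ultimately show ?thesis
    unfolding read_ok_def Let_def V_Addr ex_letter same writes_def by blast
qed

section \<open>Traces and runs\<close>

definition preamble :: "bool list \<Rightarrow> kind list" where
  "preamble x = Mark # map Load x @ [Jump]"

lemma nth_preamble:
  "preamble x ! 0 = Mark"
  "i < length x \<Longrightarrow> preamble x ! Suc i = Load (x ! i)"
  "preamble x ! Suc (length x) = Jump"
  by (simp_all add: preamble_def nth_append)

lemma preamble_cases:
  assumes "i < length x + 2"
  obtains "i = 0" "preamble x ! i = Mark"
  | i' where "i = Suc i'" "i' < length x" "preamble x ! i = Load (x ! i')"
  | "i = Suc (length x)" "preamble x ! i = Jump"
proof (cases i)
  case 0
  then show ?thesis
    using that(1) by (simp add: nth_preamble)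
next
  case (Suc i')
  then show ?thesis
    using that(2)[of i'] that(3) assms nth_preamble(2,3)[where x = x]
    by (cases "i' < length x") (auto simp: less_Suc_eq)
qed

text \<open>All heads move right in the preamble, so position and cell coincide and letter
  \<open>i\<close> has to write the initial contents of cell \<open>i\<close>.\<close>

lemma acts_preamble:
  assumes "j < num_tapes M" "i < length x + 2"
  shows "fst (acts M (preamble x ! i) ! j) = contents_of (if j = 0 then x else []) i"
    and "preamble x ! i \<noteq> Jump \<Longrightarrow> snd (acts M (preamble x ! i) ! j) = Right"
  by (cases rule: preamble_cases[OF assms(2)];
      use assms(1) in \<open>auto simp: contents_of_def nth_Cons'\<close>)+

lemma written_preamble:
  assumes l: "\<And>i. i < length x + 2 \<Longrightarrow> l i = preamble x ! i"
    and h: "\<And>i. i < length x + 2 \<Longrightarrow> h j i = i" and j: "j < num_tapes M"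
  shows "written M l h j (length x + 2) = contents_of (if j = 0 then x else [])"
proof -
  let ?c = "contents_of (if j = 0 then x else [])"
  have "written M l h j k = (\<lambda>a. if a < k then ?c a else 0)" if "k \<le> length x + 2" for k
    using that
  proof (induction k)
    case (Suc k)
    then have "written M l h j (Suc k) = (\<lambda>a. if a < k then ?c a else 0)(k := ?c k)"
      using acts_preamble(1)[OF j, of k x] l[of k] h[of k] by simp
    then show ?case
      by (auto simp: fun_eq_iff less_Suc_eq)
  qed simp
  \<comment> \<open>Beyond the cells written by the preamble both sides are blank.\<close>
  from this[OF order_refl] show ?thesis
    by (auto simp: fun_eq_iff contents_of_def)
qed

lemma step_eq_acts:
  "step M (q, ts) = (next_state M q (map read ts), map2 act (acts M (Step q (map read ts))) ts)"
proof (cases "q = accept M \<or> q = reject M")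
  case True
  then show ?thesis
    using map2_act_idle[of ts] by (auto simp: next_state_def idle_def)
next
  case False
  then show ?thesis
    by (simp add: next_state_def split_beta)
qed

lemma act_eq: "act a T = (move_head (snd a) (fst T), (snd T)(fst T := fst a))"
  by (cases a; cases T) simp

lemma run_Suc: "run M x (Suc t) = step M (run M x t)"
  by (simp add: run_def)

text \<open>The trace of a run starts with the preamble; time \<open>t\<close> is position \<open>length x + 2 + t\<close>.\<close>

lemma run_of_trace:
  assumes tm: "turing_machine M"
    and space: "\<forall>t. \<forall>T\<in>set (snd (run M x t)). fst T < 2 ^ m"
    and len: "length x + 1 < 2 ^ m"
    and letter: "letter_trace M l" and l: "\<And>i. i < length x + 2 \<Longrightarrow> l i = preamble x ! i"
    and head: "\<And>j. j < num_tapes M \<Longrightarrow> head_trace M m l h j"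
    and reads: "\<And>j. j < num_tapes M \<Longrightarrow> read_trace M l h j"
  shows "fst (run M x t) \<noteq> reject M"
proof -
  define s where "s = length x + 2"
  have K: "num_tapes M \<ge> 1"
    using tm by (simp add: turing_machine_def)
  have letters: "l i \<in> set (letters M)" "\<not> rejecting M (l i)" "follows M (l i) (l (Suc i))" for i
    using letter by (simp_all add: letter_trace_def)
  have h_preamble: "h j i = i" if "j < num_tapes M" "i < s" for i j
    using that(2)
  proof (induction i)
    case 0
    then show ?case
      using head[OF that(1)] by (simp add: head_trace_def)
  next
    case (Suc i)
    have "preamble x ! i \<noteq> Jump"
      by (rule preamble_cases[of i x]) (use Suc.prems in \<open>simp_all add: s_def\<close>)
    then have "snd (acts M (l i) ! j) = Right" "l i \<noteq> Jump"
      using acts_preamble(2)[OF that(1), of i x] l[of i] Suc.prems by (simp_all add: s_def)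
    \<comment> \<open>The bound \<open>len\<close> prevents an overflow of the address while the
      input is being written.\<close>
    moreover have "Suc i < 2 ^ m"
      using Suc.prems len by (simp add: s_def)
    ultimately show ?case
      using head[OF that(1)] Suc by (simp add: head_trace_def)
  qed
  have jump: "l (Suc (length x)) = Jump"
    using l by (simp add: nth_preamble)
  \<comment> \<open>Addresses and history reproduce the tapes of the run, and the letter carries its
    state. The symbols guessed in the letter are then forced by the read constraints.\<close>
  have inv: "snd (run M x t) = map (\<lambda>j. (h j (s + t), written M l h j (s + t))) [0..<num_tapes M]
      \<and> (\<exists>ss. l (s + t) = Step (fst (run M x t)) ss)" for t
  proof (induction t)
    case 0
    have "(h j s, written M l h j s) = (0, contents_of (if j = 0 then x else []))"
      if "j < num_tapes M" for j
    proof -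
      have "h j s = 0"
        using head[OF that] jump by (simp add: head_trace_def s_def)
      then show ?thesis
        using written_preamble[where l = l and h = h and x = x, OF l _ that] h_preamble[OF that]
        by (simp add: s_def)
    qed
    then have "snd (initial M x) = map (\<lambda>j. (h j s, written M l h j s)) [0..<num_tapes M]"
      using K by (intro nth_equalityI) (auto simp: initial_def nth_Cons')
    moreover have "\<exists>ss. l s = Step (start M) ss"
      using letters(3)[of "Suc (length x)"] jump by (simp add: s_def)
    ultimately show ?case
      by (simp add: run_def initial_def)
  next
    case (Suc t)
    define q where "q = fst (run M x t)"
    define ts where "ts = map (\<lambda>j. (h j (s + t), written M l h j (s + t))) [0..<num_tapes M]"
    have run_t: "run M x t = (q, ts)"
      using Suc.IH by (simp add: q_def ts_def prod_eq_iff)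
    obtain ss where ss: "l (s + t) = Step q ss"
      using Suc.IH by (auto simp: q_def)
    then have "length ss = num_tapes M"
      using letters(1)[of "s + t"] by (simp add: Step_in_letters)
    moreover have "ss ! j = read (ts ! j)" if "j < num_tapes M" for j
    proof -
      have "reads j (written M l h j (s + t) (h j (s + t))) (Step q ss)"
        using reads[OF that] unfolding read_trace_def ss[symmetric] by blast
      then show ?thesis
        using that by (simp add: ts_def)
    qed
    ultimately have ss_eq: "ss = map read ts"
      by (intro nth_equalityI) (simp_all add: ts_def)
    have run_Suc_t: "run M x (Suc t)
        = (next_state M q ss, map2 act (acts M (l (s + t))) ts)"
      unfolding run_Suc run_t step_eq_acts ss ss_eq ..
    have len_acts: "length (acts M (l (s + t))) = num_tapes M"
      by (rule acts_letter(1)[OF tm letters(1)])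
    have "map2 act (acts M (l (s + t))) ts
        = map (\<lambda>j. (h j (s + Suc t), written M l h j (s + Suc t))) [0..<num_tapes M]"
    proof (rule nth_equalityI)
      fix j assume "j < length (map2 act (acts M (l (s + t))) ts)"
      then have j: "j < num_tapes M"
        by (simp add: len_acts ts_def)
      let ?a = "acts M (l (s + t)) ! j"
      have nth: "map2 act (acts M (l (s + t))) ts ! j = (move_head (snd ?a) (h j (s + t)),
          (written M l h j (s + t))(h j (s + t) := fst ?a))"
        using j by (simp add: len_acts ts_def act_eq)
      \<comment> \<open>This tape belongs to the actual run, so the space bound applies to its head
        and excludes an overflow.\<close>
      have "map2 act (acts M (l (s + t))) ts ! j \<in> set (snd (run M x (Suc t)))"
        unfolding run_Suc_t snd_conv using j by (intro nth_mem) (simp add: len_acts ts_def)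
      then have "move_head (snd ?a) (h j (s + t)) < 2 ^ m"
        using space nth by (metis fst_conv)
      then have "h j (Suc (s + t)) = move_head (snd ?a) (h j (s + t))"
        using head[OF j] ss by (simp add: head_trace_def)
      then show "map2 act (acts M (l (s + t))) ts ! j
          = map (\<lambda>j. (h j (s + Suc t), written M l h j (s + Suc t))) [0..<num_tapes M] ! j"
        unfolding nth using j by simp
    qed (simp add: len_acts ts_def)
    moreover have "\<exists>ss'. l (s + Suc t) = Step (next_state M q ss) ss'"
      using letters(3)[of "s + t"] ss by simp
    ultimately show ?case
      unfolding run_Suc_t by (simp del: written.simps)
  qed
  obtain ss where "l (s + t) = Step (fst (run M x t)) ss"
    using inv[of t] by blast
  then show ?thesis
    using letters(2)[of "s + t"] by (auto simp: rejecting_def)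
qed

text \<open>States and scanned symbols have to stay in range for every step of a run to be one of
  the finitely many letters.\<close>

lemma run_invariant:
  assumes tm: "turing_machine M"
  shows "fst (run M x t) < num_states M \<and> length (snd (run M x t)) = num_tapes M \<and>
    (\<forall>T\<in>set (snd (run M x t)). range (snd T) \<subseteq> {..<num_symbols M})"
proof (induction t)
  case 0
  have "contents_of y i < num_symbols M" for y i
    using tm by (auto simp: turing_machine_def contents_of_def)
  then show ?case
    using tm by (auto simp: run_def initial_def turing_machine_def)
next
  case (Suc t)
  obtain q ts where run_t: "run M x t = (q, ts)"
    by fastforce
  let ?ss = "map read ts"
  have q: "q < num_states M" and ts: "length ts = num_tapes M"
    and sym: "T \<in> set ts \<Longrightarrow> snd T a < num_symbols M" for T a
    using Suc run_t by auto
  have "read T < num_symbols M" if "T \<in> set ts" for T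
    using sym[OF that] by (cases T) simp
  then have ss: "length ?ss = num_tapes M" "set ?ss \<subseteq> {..<num_symbols M}"
    using ts by auto
  then have letter: "Step q ?ss \<in> set (letters M)"
    using q by (simp add: Step_in_letters)
  have "next_state M q ?ss < num_states M"
    using delta_valid(1)[OF tm q ss] q by (simp add: next_state_def)
  moreover have "length (map2 act (acts M (Step q ?ss)) ts) = num_tapes M"
    using acts_letter(1)[OF tm letter] ts by simp
  moreover have "range (snd T) \<subseteq> {..<num_symbols M}"
    if T: "T \<in> set (map2 act (acts M (Step q ?ss)) ts)" for T
  proof -
    obtain j where j: "j < num_tapes M" "T = act (acts M (Step q ?ss) ! j) (ts ! j)"
      using T acts_letter(1)[OF tm letter] ts by (auto simp: in_set_conv_nth)
    then show ?thesis
      using acts_letter(2)[OF tm letter j(1)] sym[of "ts ! j"] ts by (auto simp: act_eq)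
  qed
  ultimately show ?case
    unfolding run_Suc run_t step_eq_acts by simp
qed

text \<open>The movement equations come without the overflow proviso of \<open>head_trace\<close>,
  because the positions are those of the run; a satisfying valuation is built from them in this
  form.\<close>

lemma trace_of_run:
  assumes tm: "turing_machine M"
    and space: "\<forall>t. \<forall>T\<in>set (snd (run M x t)). fst T < 2 ^ m"
    and len: "length x + 1 < 2 ^ m"
    and no_reject: "\<And>t. fst (run M x t) \<noteq> reject M"
  obtains l h where "letter_trace M l" "\<And>i. i < length x + 2 \<Longrightarrow> l i = preamble x ! i"
    "\<And>j. j < num_tapes M \<Longrightarrow> read_trace M l h j" "\<And>j. h j 0 = 0"
    "\<And>i j. j < num_tapes M \<Longrightarrow> h j i < 2 ^ m"
    "\<And>i j. j < num_tapes M \<Longrightarrow> l i = Jump \<Longrightarrow> h j (Suc i) = 0"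
    "\<And>i j. j < num_tapes M \<Longrightarrow> l i \<noteq> Jump \<Longrightarrow>
      h j (Suc i) = move_head (snd (acts M (l i) ! j)) (h j i)"
proof -
  define s where "s = length x + 2"
  define c where "c t = run M x t" for t
  define l where "l i = (if i < s then preamble x ! i
      else Step (fst (c (i - s))) (map read (snd (c (i - s)))))" for i
  define h where "h j i = (if i < s then i else fst (snd (c (i - s)) ! j))" for j i
  have c_Suc: "fst (c (Suc t)) = next_state M (fst (c t)) (map read (snd (c t)))"
      "snd (c (Suc t)) = map2 act (acts M (Step (fst (c t)) (map read (snd (c t))))) (snd (c t))" for t
    using step_eq_acts[of M "fst (c t)" "snd (c t)"] by (simp_all add: c_def run_Suc)
  note inv = run_invariant[OF tm, of x, folded c_def]
  have inv_read: "read T < num_symbols M" if "T \<in> set (snd (c t))" for t T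
    using inv[of t] that by (cases T) force
  have letter: "Step (fst (c t)) (map read (snd (c t))) \<in> set (letters M)" for t
    using inv[of t] inv_read[of _ t] by (auto simp: Step_in_letters)
  have l_pre: "l i = preamble x ! i" if "i < s" for i
    using that by (simp add: l_def)
  have l_run: "l (s + t) = Step (fst (c t)) (map read (snd (c t)))" for t
    by (simp add: l_def)
  have h_run: "h j (s + t) = fst (snd (c t) ! j)" for j t
    by (simp add: h_def)
  have init: "snd (c 0) ! j = (0, contents_of (if j = 0 then x else []))" if "j < num_tapes M" for j
    using that by (simp add: c_def run_def initial_def nth_Cons')
  have letters: "letter_trace M l"
    unfolding letter_trace_def
  proof
    fix i
    show "l i \<in> set (letters M) \<and> \<not> rejecting M (l i) \<and> follows M (l i) (l (Suc i))"
    proof (cases "i < s")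
      case True
      then have "i < length x + 2"
        by (simp add: s_def)
      then show ?thesis
      proof (cases rule: preamble_cases)
        case 1
        then have "l i = Mark"
          using l_pre[OF True] by simp
        then show ?thesis
          by (simp add: rejecting_def)
      next
        case (2 i')
        then have "l i = Load (x ! i')"
          using l_pre[OF True] by simp
        then show ?thesis
          by (simp add: rejecting_def)
      next
        case 3
        then have "l i = Jump"
          using l_pre[OF True] by simp
        moreover have "l (Suc i) = Step (start M) (map read (snd (c 0)))"
          using l_run[of 0] 3 by (simp add: s_def c_def run_def initial_def)
        ultimately show ?thesis
          by (simp add: rejecting_def)
      qed
    next
      case False
      then obtain t where "i = s + t"
        using le_Suc_ex linorder_not_less by blast
      then show ?thesis
        using letter[of t] l_run[of t] l_run[of "Suc t"] c_Suc(1)[of t] no_reject[of t]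
        by (simp add: rejecting_def c_def)
    qed
  qed
  have nth_Suc: "snd (c (Suc t)) ! j = act (acts M (l (s + t)) ! j) (snd (c t) ! j)"
    if "j < num_tapes M" for j t
    using that inv[of t] acts_letter(1)[OF tm letter[of t]] by (simp add: c_Suc(2) l_run)
  have moves: "h j (Suc i) = move_head (snd (acts M (l i) ! j)) (h j i)"
    if j: "j < num_tapes M" and "l i \<noteq> Jump" for i j
  proof (cases "i < s")
    case True
    then have "i \<noteq> Suc (length x)"
      using that(2) by (auto simp: l_pre nth_preamble)
    then have "Suc i < s"
      using True by (simp add: s_def)
    moreover have "snd (acts M (l i) ! j) = Right"
      using acts_preamble(2)[OF j, of i x] True that(2) by (simp add: l_pre s_def)
    ultimately show ?thesis
      by (simp add: h_def)
  next
    case False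
    then obtain t where "i = s + t"
      using le_Suc_ex linorder_not_less by blast
    then show ?thesis
      using nth_Suc[OF j, of t] h_run[of j t] h_run[of j "Suc t"] by (simp add: act_eq)
  qed
  have jump: "h j (Suc i) = 0" if j: "j < num_tapes M" and "l i = Jump" for i j
  proof -
    have "i < s"
      using that(2) by (auto simp: l_def split: if_splits)
    then have "i < length x + 2"
      by (simp add: s_def)
    moreover have "preamble x ! i = Jump"
      using that(2) l_pre[OF \<open>i < s\<close>] by simp
    ultimately have "Suc i = s"
      by (elim preamble_cases) (simp_all add: s_def)
    then show ?thesis
      using h_run[of j 0] init[OF j] by simp
  qed
  have less: "h j i < 2 ^ m" if "j < num_tapes M" for i j
  proof (cases "i < s")
    case True
    then show ?thesis
      using len by (simp add: h_def s_def)
  next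
    case False
    then show ?thesis
      using space[rule_format, of "snd (c (i - s)) ! j" "i - s"] that inv[of "i - s"] by (simp add: h_def c_def)
  qed
  have contents: "written M l h j (s + t) = snd (snd (c t) ! j)" if j: "j < num_tapes M" for j t
  proof (induction t)
    case 0
    have "h j i = i" if "i < length x + 2" for i
      using that by (simp add: h_def s_def)
    from written_preamble[where l = l and h = h and x = x, OF l_pre[unfolded s_def] this j]
    show ?case
      using init[OF j] by (simp add: s_def del: written.simps)
  next
    case (Suc t)
    then show ?case
      using nth_Suc[OF j, of t] h_run[of j t] by (simp add: act_eq)
  qed
  have "read_trace M l h j" if j: "j < num_tapes M" for j
    unfolding read_trace_def
  proof
    fix i
    show "reads j (written M l h j i (h j i)) (l i)"
    proof (cases "i < s")
      case True
      then have "i < length x + 2"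
        by (simp add: s_def)
      then have "reads j a (preamble x ! i)" for a
        by (rule preamble_cases) simp_all
      then show ?thesis
        by (simp only: l_pre[OF True])
    next
      case False
      then obtain t where i: "i = s + t"
        using le_Suc_ex linorder_not_less by blast
      have "read T = snd T (fst T)" for T
        by (cases T) simp
      then show ?thesis
        using j inv[of t] by (simp add: i l_run contents[OF j] h_run)
    qed
  qed
  moreover have "h j 0 = 0" for j
    by (simp add: h_def s_def)
  ultimately show ?thesis
    using that[of l h] letters l_pre moves jump less unfolding s_def by blast
qed

section \<open>The reduction\<close>

text \<open>\<open>Weak_Next\<close> makes the chain true on prefixes shorter than the list. The
  nesting spends one block on each letter, so the chain can be printed during a single scan of the
  input.\<close>

primrec chain :: "nat list \<Rightarrow> nat ltlf" where
  "chain [] = tt (Prop 0)"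
| "chain (p # ps) = Conj (Prop p) (Weak_Next (chain ps))"

lemma sem_chain:
  "i < n \<Longrightarrow> sem V n i (chain ps) \<longleftrightarrow> (\<forall>k<length ps. i + k < n \<longrightarrow> V (ps ! k) (i + k))"
  by (induction ps arbitrary: i) (auto simp: All_less_Suc2)

lemma sem_chain_all: "(\<forall>n. sem V (Suc n) 0 (chain ps)) \<longleftrightarrow> (\<forall>k<length ps. V (ps ! k) k)"
  by (auto simp: sem_chain)

text \<open>The nine trailing bits are the tokens of \<open>Neg\<close>, \<open>Next\<close>,
  \<open>Neg\<close>, into which \<open>Weak_Next\<close> expands.\<close>

definition encode_link :: "nat \<Rightarrow> bool list" where
  "encode_link p = [False, True, False] @ encode (Prop p)
     @ [False, False, True, False, True, True, False, False, True]"

lemma encode_chain: "encode (chain ps) = concat (map encode_link ps) @ encode (tt (Prop (0::nat)))"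
  by (induction ps) (simp_all add: encode_link_def Weak_Next_def)

definition kinds :: "tm \<Rightarrow> kind set" where
  "kinds M = set (letters M) \<union> Addr ` {..<num_tapes M} \<union> Carry ` {..<num_tapes M}"

text \<open>The base exceeds the number of every kind that occurs, so
  \<open>b * atom_base M + to_nat k\<close> determines \<open>b\<close> and \<open>k\<close> by
  division with remainder.\<close>

definition atom_base :: "tm \<Rightarrow> nat" where
  "atom_base M = Suc (Max (to_nat ` kinds M))"

lemma to_nat_less_atom_base: "k \<in> kinds M \<Longrightarrow> to_nat k < atom_base M"
  by (simp add: atom_base_def kinds_def less_Suc_eq_le)

definition reduction :: "tm \<Rightarrow> nat \<Rightarrow> bool list \<Rightarrow> nat ltlf" where
  "reduction M m x = Conj (chain (map to_nat (preamble x)))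
     (subst (ground (atom_base M) to_nat m) (schema M))"

lemma preamble_subset_letters: "set (preamble x) \<subseteq> set (letters M)"
  by (auto simp: preamble_def)

lemma length_preamble: "length (preamble x) = length x + 2"
  by (simp add: preamble_def)

lemma sem_reduction:
  "(\<forall>n. sem W (Suc n) 0 (reduction M m x)) \<longleftrightarrow>
     (\<forall>i<length x + 2. W (to_nat (preamble x ! i)) i) \<and>
     letter_ok M (\<lambda>k b. W (b * atom_base M + to_nat k)) \<and>
     (\<forall>j<num_tapes M. head_ok M m (\<lambda>k b. W (b * atom_base M + to_nat k)) j \<and>
       read_ok M m (\<lambda>k b. W (b * atom_base M + to_nat k)) j)"
  unfolding sem_schema[symmetric]
  by (simp add: reduction_def all_conj_distrib sem_ground sem_chain_all length_preamble
      del: length_map cong: conj_cong) (simp add: length_preamble)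

lemma forall_satisfiable_reduction:
  assumes tm: "turing_machine M"
    and space: "\<forall>t. \<forall>T\<in>set (snd (run M x t)). fst T < 2 ^ m"
    and len: "length x + 1 < 2 ^ m"
  shows "forall_satisfiable (atoms (reduction M m x)) (reduction M m x) \<longleftrightarrow>
    (\<forall>t. fst (run M x t) \<noteq> reject M)"
proof
  assume "forall_satisfiable (atoms (reduction M m x)) (reduction M m x)"
  then obtain W where W: "\<forall>n. sem W (Suc n) 0 (reduction M m x)"
    unfolding forall_satisfiable_iff_sem ..
  define V where "V k b = W (b * atom_base M + to_nat k)" for k :: kind and b
  note ok = W[unfolded sem_reduction, folded V_def]
  obtain l h where tr: "letter_trace M l" "\<And>l' i. l' \<in> set (letters M) \<Longrightarrow> V l' 0 i \<longleftrightarrow> l' = l i"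
    "\<And>j. j < num_tapes M \<Longrightarrow> head_trace M m l h j" "\<And>j. j < num_tapes M \<Longrightarrow> read_trace M l h j"
    using trace_of_valuation[OF tm, of V m] ok by blast
  have pre: "l i = preamble x ! i" if "i < length x + 2" for i
  proof -
    have "preamble x ! i \<in> set (letters M)"
      using that preamble_subset_letters[of x M] length_preamble[of x] nth_mem[of i "preamble x"]
      by auto
    moreover have "V (preamble x ! i) 0 i"
      using ok that by (simp add: V_def)
    ultimately show ?thesis
      using tr(2) by simp
  qed
  have "fst (run M x t) \<noteq> reject M" for t
    by (rule run_of_trace[OF tm space len tr(1) pre tr(3,4)])
  then show "\<forall>t. fst (run M x t) \<noteq> reject M"
    by blast
next
  assume "\<forall>t. fst (run M x t) \<noteq> reject M"
  then have no_reject: "\<And>t. fst (run M x t) \<noteq> reject M"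
    by blast
  obtain l h where l: "letter_trace M l" "\<And>i. i < length x + 2 \<Longrightarrow> l i = preamble x ! i"
    and reads: "\<And>j. j < num_tapes M \<Longrightarrow> read_trace M l h j"
    and h: "\<And>j. h j 0 = 0" "\<And>i j. j < num_tapes M \<Longrightarrow> h j i < 2 ^ m"
      "\<And>i j. j < num_tapes M \<Longrightarrow> l i = Jump \<Longrightarrow> h j (Suc i) = 0"
      "\<And>i j. j < num_tapes M \<Longrightarrow> l i \<noteq> Jump \<Longrightarrow>
        h j (Suc i) = move_head (snd (acts M (l i) ! j)) (h j i)"
    using trace_of_run[OF tm space len no_reject] by blast
  define U where "U k b i = (case k of Addr j \<Rightarrow> bit (h j i) b
      | Carry j \<Rightarrow> carry (snd (acts M (l i) ! j)) (h j i) b | _ \<Rightarrow> k = l i)" for k b i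
  \<comment> \<open>The atom number is decoded by quotient and remainder; on the kinds that occur,
    \<open>V\<close> then agrees with \<open>U\<close>.\<close>
  define W where "W p i = U (from_nat (p mod atom_base M)) (p div atom_base M) i" for p i
  define V where "V k b = W (b * atom_base M + to_nat k)" for k :: kind and b
  have V: "V k b i = U k b i" if "k \<in> kinds M" for k b i
    using to_nat_less_atom_base[OF that] by (simp add: V_def W_def)
  have V_letter: "V l' 0 i \<longleftrightarrow> l' = l i" if "l' \<in> set (letters M)" for l' i
  proof -
    have "V l' 0 i = U l' 0 i"
      using that by (intro V) (simp add: kinds_def)
    also have "\<dots> \<longleftrightarrow> l' = l i"
      by (rule letter_cases[OF that]) (simp_all add: U_def)
    finally show ?thesis .
  qed
  have V_Addr: "V (Addr j) b i \<longleftrightarrow> bit (h j i) b" if "j < num_tapes M" for j b i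
    using that by (simp add: V kinds_def U_def)
  have V_Carry: "V (Carry j) b i \<longleftrightarrow> carry (snd (acts M (l i) ! j)) (h j i) b"
    if "j < num_tapes M" for j b i
    using that by (simp add: V kinds_def U_def)
  have "letter_ok M V"
    by (rule letter_ok_of_trace[where V = V and l = l, OF l(1) V_letter])
  moreover have "head_ok M m V j" if "j < num_tapes M" for j
    by (rule head_ok_of_trace[where h = h and V = V and l = l, OF l(1) V_letter V_Addr V_Carry])
      (use that h in simp_all)
  moreover have "read_ok M m V j" if "j < num_tapes M" for j
    by (rule read_ok_of_trace[where h = h and V = V and l = l, OF l(1) V_letter V_Addr h(2) reads])
      (use that in simp_all)
  moreover have "W (to_nat (preamble x ! i)) i" if "i < length x + 2" for i
  proof -
    have "l i \<in> set (letters M)"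
      using l(1) by (simp add: letter_trace_def)
    then have "V (l i) 0 i"
      using V_letter by blast
    then show ?thesis
      using l(2)[OF that] by (simp add: V_def)
  qed
  ultimately have "\<forall>n. sem W (Suc n) 0 (reduction M m x)"
    unfolding sem_reduction V_def[symmetric] by blast
  then show "forall_satisfiable (atoms (reduction M m x)) (reduction M m x)"
    unfolding forall_satisfiable_iff_sem by blast
qed

section \<open>Membership as never rejecting, and the choice of the number of bits\<close>

lemma reject_stays: "fst (run M x t) = reject M \<Longrightarrow> fst (run M x (t + k)) = reject M"
proof (induction k)
  case (Suc k)
  then show ?case
    by (cases "run M x (t + k)") (simp add: run_Suc)
qed simp

lemma accept_stays: "fst (run M x t) = accept M \<Longrightarrow> fst (run M x (t + k)) = accept M"
proof (induction k)
  case (Suc k)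
  then show ?case
    by (cases "run M x (t + k)") (simp add: run_Suc)
qed simp

text \<open>Halting states are absorbing, so a run visiting both would be in both at a common later
  time.\<close>

lemma decides_iff_no_reject:
  assumes "turing_machine M" "decides M L"
  shows "x \<in> L \<longleftrightarrow> (\<forall>t. fst (run M x t) \<noteq> reject M)"
proof
  assume "x \<in> L"
  then obtain t where "fst (run M x t) = accept M"
    using assms(2) unfolding decides_def by metis
  moreover have "accept M \<noteq> reject M"
    using assms(1) by (simp add: turing_machine_def)
  ultimately show "\<forall>t. fst (run M x t) \<noteq> reject M"
    using accept_stays[of M x t] reject_stays[of M x] by (metis add.commute)
next
  assume "\<forall>t. fst (run M x t) \<noteq> reject M"
  then show "x \<in> L"
    using assms(2) unfolding decides_def by metis
qed

text \<open>The printing machine computes its number of bits by multiplication alone, so the given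
  polynomial is replaced by a monomial. The base \<open>n + 1\<close> is positive also for the empty
  input.\<close>

lemma poly_le_monomial:
  fixes p :: "nat poly"
  obtains a d where "\<And>n. poly p n \<le> a * (n + 1) ^ d"
proof -
  have "\<exists>a d. \<forall>n. poly p n \<le> a * (n + 1) ^ d"
  proof (induction p)
    case 0
    show ?case
      by simp
  next
    case (pCons c p)
    then obtain a d where a: "\<And>n. poly p n \<le> a * (n + 1) ^ d"
      by blast
    have "poly (pCons c p) n \<le> (c + a) * (n + 1) ^ Suc d" for n
    proof -
      have "c * 1 \<le> c * (n + 1) ^ Suc d"
        by (intro mult_le_mono2 one_le_power) simp
      moreover have "n * poly p n \<le> (n + 1) * (a * (n + 1) ^ d)"
        by (intro mult_le_mono a) simp
      ultimately show ?thesis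
        by (simp add: algebra_simps)
    qed
    then show ?case
      by blast
  qed
  then show ?thesis
    using that by blast
qed

lemma polytime_computable_reduction:
  "polytime_computable (\<lambda>x. encode (reduction M (a * (length x + 1) ^ d) x))"
proof -
  let ?e = "\<lambda>k :: kind. encode_link (to_nat k)"
  \<comment> \<open>The input enters through the \<open>Load\<close> blocks, one for each bit;
    everything around them is constant except the grounded schema, which depends on the length
    alone.\<close>
  have "encode (reduction M (a * (length x + 1) ^ d) x)
      = ([False, True, False] @ ?e Mark) @ concat (map (\<lambda>b. ?e (Load b)) x)
        @ (?e Jump @ encode (tt (Prop (0::nat))))
        @ encode (subst (ground (atom_base M) to_nat (a * (length x + 1) ^ d)) (schema M))" for x
    unfolding reduction_def encode.simps(3) encode_chain by (simp add: preamble_def o_def)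
  then show ?thesis
    using polytime_computable_schema[of "[False, True, False] @ ?e Mark" "\<lambda>b. ?e (Load b)"
        "?e Jump @ encode (tt (Prop (0::nat)))" "atom_base M" to_nat a d "schema M"]
    by (simp only:)
qed

theorem theorem8: "EXPSPACE_hard forall_SAT"
  unfolding EXPSPACE_hard_def
proof
  fix A
  assume "A \<in> EXPSPACE"
  then obtain M and p :: "nat poly" where tm: "turing_machine M" and dec: "decides M A"
    and space: "runs_in_space M (\<lambda>n. 2 ^ poly p n)"
    by (auto simp: EXPSPACE_def)
  \<comment> \<open>The summand \<open>[:1, 1:]\<close> stands for \<open>n + 1\<close>: the
    addresses must reach the cells written by the preamble as well as those within the space
    bound.\<close>
  obtain a d where ad: "\<And>n. poly (p + [:1, 1:]) n \<le> a * (n + 1) ^ d"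
    using poly_le_monomial by blast
  define m where "m n = a * (n + 1) ^ d" for n
  have m: "poly p n \<le> m n" "n + 1 \<le> m n" for n
    using ad[of n] by (simp_all add: m_def)
  have "x \<in> A \<longleftrightarrow> encode (reduction M (m (length x)) x) \<in> forall_SAT" for x
  proof -
    have "2 ^ poly p (length x) \<le> (2::nat) ^ m (length x)"
      using m(1) by (intro power_increasing) simp_all
    then have "\<forall>t. \<forall>T\<in>set (snd (run M x t)). fst T < 2 ^ m (length x)"
      using space unfolding runs_in_space_def by (meson less_le_trans)
    moreover have "length x + 1 < 2 ^ m (length x)"
      by (rule le_less_trans[OF m(2) less_exp])
    ultimately have "forall_satisfiable (atoms (reduction M (m (length x)) x))
        (reduction M (m (length x)) x) \<longleftrightarrow> x \<in> A"
      unfolding decides_iff_no_reject[OF tm dec] by (rule forall_satisfiable_reduction[OF tm])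
    then show ?thesis
      using injD[OF inj_encode] by (auto simp: forall_SAT_def)
  qed
  then show "polytime_reducible A forall_SAT"
    unfolding polytime_reducible_def
    using polytime_computable_reduction[of M a d] by (auto simp: m_def)
qed

end
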